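(* Let $\bar Q$ be a Markov transition operator on $\mathbb{R}^d$. Suppose there exist $\bar M>1>\bar w>0$ such that $$\mathcal{W}_2(\mu\bar Q^k,\nu\bar Q^k)\le\bar M(1-\bar w)^k\,\mathcal{W}_2(\mu,\nu)\qquad\text{for all }\mu,\nu\in\mathcal{P}(\mathbb{R}^d)\text{ and all }k\in\mathbb{N}.$$ Suppose moreover that $\bar Q$ satisfies the local Poincaré inequality with constant $C_{LP}$. Then for every $k\in\mathbb{N}$, $\bar Q^k$ satisfies the local Poincaré inequality with constant $$\frac{C_{LP}\bar M^2}{1-(1-\bar w)^2}.$$ Moreover, the invariant measure of $\bar Q$ also satisfies the Poincaré inequality with the same constant.
   Context: $\mathcal{P}(\mathbb{R}^d)$ is the set of Borel probability measures on $\mathbb{R}^d$ and $\mathcal{W}_2$ is the $L^2$-Wasserstein distance for the Euclidean distance, $\mathcal{W}_2(\mu,\nu)=\left(\inf_{\pi\in\Pi(\mu,\nu)}\int|x-y|^2d\pi(x,y)\right)^{1/2}$ with $\Pi(\mu,\nu)$ the set of couplings. A probability measure $m$ on $\mathbb{R}^d$ satisfies the Poincaré inequality with constant $C$ if $\int f^2dm-\left(\int f\,dm\right)^2\le C\int|\nabla f|^2dm$ for every $f\in\mathcal{C}^\infty(\mathbb{R}^d)$ with polynomial growth. A Markov transition kernel $\bar Q$ satisfies the local Poincaré inequality with constant $C$ if for every $x\in\mathbb{R}^d$ the measure $\bar Q(x,\cdot)$ satisfies the Poincaré inequality with constant $C$, i.e. $\bar Qf^2(x)-(\bar Qf)^2(x)\le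 C\,\bar Q|\nabla f|^2(x)$ for all $x$ and all $f\in\mathcal{C}^\infty(\mathbb{R}^d)$ with polynomial growth. *)

theory Defs
  imports "HOL-Probability.Probability"
begin

abbreviation prob_measures :: "'a::euclidean_space measure set" where
  "prob_measures \<equiv> space (prob_algebra borel)"

definition couplings ::
  "'a::euclidean_space measure \<Rightarrow> 'a measure \<Rightarrow> ('a \<times> 'a) measure set" where
  "couplings \<mu> \<nu> =
     {\<pi> \<in> space (prob_algebra (borel \<Otimes>\<^sub>M borel)).
        distr \<pi> borel fst = \<mu> \<and> distr \<pi> borel snd = \<nu>}"

(* The square root is extended to [0, \<infinity>] by sqrt \<infinity> = \<infinity>: the distance is infinite
   when every coupling has infinite quadratic cost. *)
definition W2 :: "'a::euclidean_space measure \<Rightarrow> 'a measure \<Rightarrow> ennreal" where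
  "W2 \<mu> \<nu> =
     (let I = (INF \<pi>\<in>couplings \<mu> \<nu>. \<integral>\<^sup>+ z. ennreal ((norm (fst z - snd z))\<^sup>2) \<partial>\<pi>)
      in if I = \<infinity> then \<infinity> else ennreal (sqrt (enn2real I)))"

primrec C_diff :: "nat \<Rightarrow> ('a::euclidean_space \<Rightarrow> real) \<Rightarrow> bool" where
  "C_diff 0 f \<longleftrightarrow> continuous_on UNIV f"
| "C_diff (Suc n) f \<longleftrightarrow>
     (\<forall>x. f differentiable (at x)) \<and>
     (\<forall>b\<in>Basis. C_diff n (\<lambda>x. frechet_derivative f (at x) b))"

definition C_inf :: "('a::euclidean_space \<Rightarrow> real) \<Rightarrow> bool" where
  "C_inf f \<longleftrightarrow> (\<forall>n. C_diff n f)"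

definition poly_growth :: "('a::euclidean_space \<Rightarrow> real) \<Rightarrow> bool" where
  "poly_growth f \<longleftrightarrow> (\<exists>K n. \<forall>x. \<bar>f x\<bar> \<le> K * (1 + norm x) ^ n)"

definition grad :: "('a::euclidean_space \<Rightarrow> real) \<Rightarrow> 'a \<Rightarrow> 'a" where
  "grad f x = (\<Sum>b\<in>Basis. frechet_derivative f (at x) b *\<^sub>R b)"

lemma GDERIV_grad:
  assumes "f differentiable (at x)"
  shows "GDERIV f x :> grad f x"
proof -
  have D: "(f has_derivative frechet_derivative f (at x)) (at x)"
    using assms frechet_derivative_works by blast
  interpret bounded_linear "frechet_derivative f (at x)"
    using D by (rule has_derivative_bounded_linear)
  have "frechet_derivative f (at x) h = h \<bullet> grad f x" for h
  proof -
    have "frechet_derivative f (at x) h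
        = frechet_derivative f (at x) (\<Sum>b\<in>Basis. (h \<bullet> b) *\<^sub>R b)"
      by (simp add: euclidean_representation)
    also have "\<dots> = h \<bullet> grad f x"
      by (simp add: sum scaleR grad_def inner_sum_right mult.commute)
    finally show ?thesis .
  qed
  then have "frechet_derivative f (at x) = (\<lambda>h. h \<bullet> grad f x)"
    by blast
  with D show ?thesis
    by (simp add: gderiv_def)
qed

(* The integrals of f^2 and |grad f|^2 are taken in [0, \<infinity>] and the inequality is read in the
   extended reals, since neither integral is assumed finite: only f itself has polynomial growth.
   If f^2 is not integrable, then the left-hand side is \<infinity>, whatever value the Bochner integral
   of f takes; if it is integrable, then so is f, m being a probability measure. *)
definition poincare :: "'a::euclidean_space measure \<Rightarrow> real \<Rightarrow> bool" where
  "poincare m C \<longleftrightarrow>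
     (\<forall>f. C_inf f \<and> poly_growth f \<longrightarrow>
        enn2ereal (\<integral>\<^sup>+ x. ennreal ((f x)\<^sup>2) \<partial>m) - ereal ((\<integral> x. f x \<partial>m)\<^sup>2)
          \<le> ereal C * enn2ereal (\<integral>\<^sup>+ x. ennreal ((norm (grad f x))\<^sup>2) \<partial>m))"

abbreviation markov_kernel :: "('a::euclidean_space \<Rightarrow> 'a measure) \<Rightarrow> bool" where
  "markov_kernel Q \<equiv> Q \<in> borel \<rightarrow>\<^sub>M prob_algebra borel"

(* The measure \<mu>Q is \<mu> \<bind> Q, and \<mu>Q^k is \<mu> \<bind> kernel_pow Q k. *)
primrec kernel_pow ::
  "('a::euclidean_space \<Rightarrow> 'a measure) \<Rightarrow> nat \<Rightarrow> 'a \<Rightarrow> 'a measure" where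
  "kernel_pow Q 0 = return borel"
| "kernel_pow Q (Suc k) = (\<lambda>x. kernel_pow Q k x \<bind> Q)"

definition local_poincare :: "('a::euclidean_space \<Rightarrow> 'a measure) \<Rightarrow> real \<Rightarrow> bool" where
  "local_poincare Q C \<longleftrightarrow> (\<forall>x. poincare (Q x) C)"

definition invariant_measure ::
  "('a::euclidean_space \<Rightarrow> 'a measure) \<Rightarrow> 'a measure \<Rightarrow> bool" where
  "invariant_measure Q m \<longleftrightarrow> m \<in> prob_measures \<and> m \<bind> Q = m"

end

(* By Kuwada duality, the contraction of W2 yields |grad Q^k f|^2 <= c_k^2 Q^k |grad f|^2 with
   c_k = M (1 - w)^k. Writing Q^k f^2 - (Q^k f)^2 as a telescoping sum of the terms
   Q^(k-1-j) (Q (Q^j f)^2 - (Q^(j+1) f)^2) and applying the local Poincare inequality of Q to each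
   Q^j f bounds it by C_LP (sum of c_j^2) Q^k |grad f|^2, a geometric sum. An invariant measure m
   satisfies the same bound for every k, and the Lipschitz constant of Q^k f tends to 0, so that
   Q^k f converges to the mean of f under m.

   Since Q^j f need not be smooth, the Poincare inequality is first transferred to Lipschitz
   functions g with a continuous local Lipschitz bound G in place of |grad g|: the convolution of g
   with a Gaussian is smooth, and its gradient is dominated by the convolution of G. Truncating f
   and multiplying it by a Lipschitz cutoff leads from smooth functions to this class. *)
theory Submission
  imports Defs
begin

text \<open>The remainder \<open>K * (dist x y)\<^sup>2\<close> in \<open>upgrad\<close> is what
  fits the class to \<open>W2\<close>: integrated against a coupling, the term linear in the
  distance becomes, by Cauchy-Schwarz, the L^2 norm of \<open>G\<close> times the root of the cost,
  and the remainder becomes \<open>K\<close> times the cost. Kernels at \<open>W2\<close> distance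
  at most \<open>c * dist x y\<close> therefore reproduce a bound of the same form, with a remainder
  that is again quadratic. Since M > 1, a single step may expand distances, and iterating a one-step
  gradient bound would give the factors (M (1 - w))^j, which need not be summable. The bound for Q^j
  is drawn instead from the contraction hypothesis at the power j itself. Functions of polynomial
  growth are not assumed square integrable. The finiteness of second moments has to be extracted
  from the inequality for truncations before dominated convergence can be used on the
  variance.\<close>

section \<open>Gaussian mollification\<close>

text \<open>Closure under directional derivatives replaces any formula for the n-th derivative: the
  recursion of \<open>C_diff\<close> never leaves \<open>S\<close>, and differentiability of its
  members gives the continuity required at the base.\<close>

lemma C_inf_family:
  assumes deriv: "\<And>f. f \<in> S \<Longrightarrow> \<exists>D. (\<forall>x. (f has_derivative D x) (at x)) \<and> (\<forall>h. (\<lambda>x. D x h) \<in> S)"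
    and "f \<in> S"
  shows "C_inf f"
proof -
  have "C_diff n f" if "f \<in> S" for n f
    using that
  proof (induction n arbitrary: f)
    case 0
    with deriv obtain D where "\<And>x. (f has_derivative D x) (at x)" by blast
    then show ?case
      by (auto intro!: continuous_at_imp_continuous_on has_derivative_continuous)
  next
    case (Suc n)
    with deriv obtain D where D: "\<And>x. (f has_derivative D x) (at x)" "\<And>h. (\<lambda>x. D x h) \<in> S"
      by metis
    then have "frechet_derivative f (at x) = D x" for x
      using frechet_derivative_at by metis
    with D Suc.IH show ?case
      by (auto simp: differentiable_def)
  qed
  with \<open>f \<in> S\<close> show ?thesis
    by (simp add: C_inf_def)
qed

lemma C_inf_inner: "C_inf (\<lambda>x. x \<bullet> a :: real)"
proof (rule C_inf_family[where S = "{f. \<exists>c a. f = (\<lambda>x. c + x \<bullet> a)}"])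
  fix f :: "'a \<Rightarrow> real"
  assume "f \<in> {f. \<exists>c a. f = (\<lambda>x. c + x \<bullet> a)}"
  then obtain c a where f: "f = (\<lambda>x. c + x \<bullet> a)" by blast
  have "(f has_derivative (\<lambda>h. h \<bullet> a)) (at x)" for x
    unfolding f by (auto intro!: derivative_eq_intros)
  moreover have "(\<lambda>x::'a. h \<bullet> a) = (\<lambda>x. (h \<bullet> a) + x \<bullet> 0)" for h
    by simp
  ultimately show "\<exists>D. (\<forall>x. (f has_derivative D x) (at x)) \<and>
      (\<forall>h. (\<lambda>x. D x h) \<in> {f. \<exists>c a. f = (\<lambda>x. c + x \<bullet> a)})"
    by (intro exI[of _ "\<lambda>x h. h \<bullet> a"]) blast
next
  show "(\<lambda>x. x \<bullet> a) \<in> {f. \<exists>c a. f = (\<lambda>x. c + x \<bullet> a)}"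
    by (auto intro!: exI[of _ 0] exI[of _ a])
qed

text \<open>Polynomials times a Gaussian. Differentiating the Gaussian brings down a linear factor,
  so by the product rule the family is closed under derivatives, as \<open>C_inf_family\<close>
  requires.\<close>

inductive gauss_poly :: "real \<Rightarrow> ('a::euclidean_space \<Rightarrow> real) \<Rightarrow> bool" for s where
  gauss: "gauss_poly s (\<lambda>x. exp (- s * (x \<bullet> x)))"
| scale: "gauss_poly s f \<Longrightarrow> gauss_poly s (\<lambda>x. c * f x)"
| add: "gauss_poly s f \<Longrightarrow> gauss_poly s g \<Longrightarrow> gauss_poly s (\<lambda>x. f x + g x)"
| linear: "gauss_poly s f \<Longrightarrow> gauss_poly s (\<lambda>x. (x \<bullet> a) * f x)"

lemma gauss_poly_derivative:
  assumes "gauss_poly s f"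
  shows "\<exists>D. (\<forall>x. (f has_derivative D x) (at x)) \<and> (\<forall>h. gauss_poly s (\<lambda>x. D x h))"
  using assms
proof induction
  case gauss
  have "((\<lambda>x. exp (- s * (x \<bullet> x))) has_derivative
      (\<lambda>h. (- 2 * s) * ((x \<bullet> h) * exp (- s * (x \<bullet> x))))) (at x)" for x :: 'a
    by (auto intro!: derivative_eq_intros simp: inner_commute algebra_simps)
  then show ?case
    by (intro exI[of _ "\<lambda>x h. (- 2 * s) * ((x \<bullet> h) * exp (- s * (x \<bullet> x)))"])
      (intro conjI allI gauss_poly.intros)
next
  case (scale f c)
  then obtain D where "\<And>x. (f has_derivative D x) (at x)" "\<And>h. gauss_poly s (\<lambda>x. D x h)"
    by blast
  then show ?case
    by (intro exI[of _ "\<lambda>x h. c * D x h"])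
      (auto intro!: gauss_poly.intros has_derivative_mult_right)
next
  case (add f g)
  then obtain D E where "\<And>x. (f has_derivative D x) (at x)" "\<And>h. gauss_poly s (\<lambda>x. D x h)"
    "\<And>x. (g has_derivative E x) (at x)" "\<And>h. gauss_poly s (\<lambda>x. E x h)"
    by blast
  then show ?case
    by (intro exI[of _ "\<lambda>x h. D x h + E x h"])
      (auto intro!: gauss_poly.intros has_derivative_add)
next
  case (linear f a)
  then obtain D where D: "\<And>x. (f has_derivative D x) (at x)" "\<And>h. gauss_poly s (\<lambda>x. D x h)"
    by blast
  have "((\<lambda>x. (x \<bullet> a) * f x) has_derivative (\<lambda>h. (x \<bullet> a) * D x h + (h \<bullet> a) * f x)) (at x)" for x
    by (auto intro!: derivative_eq_intros D)
  with linear D show ?case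
    by (intro exI[of _ "\<lambda>x h. (x \<bullet> a) * D x h + (h \<bullet> a) * f x"])
      (auto intro!: gauss_poly.intros)
qed

lemma gauss_poly_continuous:
  assumes "gauss_poly s f"
  shows "continuous_on A f"
proof -
  obtain D where "\<And>x. (f has_derivative D x) (at x)"
    using gauss_poly_derivative[OF assms] by blast
  then show ?thesis
    by (auto intro!: continuous_at_imp_continuous_on has_derivative_continuous)
qed

text \<open>The point \<open>x\<close> occurs only in the factor \<open>k\<close>, so continuity of
  \<open>g\<close> suffices for differentiating under the integral. Over a compact box the Leibniz
  rule asks only for joint continuity of the derivative as a bounded linear map, which in finite
  dimension can be checked on each vector \<open>h\<close>.\<close>

lemma gauss_poly_convolution_derivative:
  fixes g k :: "'a::euclidean_space \<Rightarrow> real"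
  assumes g: "continuous_on UNIV g" and k: "gauss_poly s k"
    and D: "\<And>x. (k has_derivative D x) (at x)" "\<And>h. gauss_poly s (\<lambda>x. D x h)"
  shows "((\<lambda>x. integral (cbox a b) (\<lambda>t. g t * k (x - t))) has_derivative
           (\<lambda>h. integral (cbox a b) (\<lambda>t. g t * D (x - t) h))) (at x)"
proof -
  define fx where "fx x t = Blinfun (\<lambda>h. g t * D (x - t) h)" for x t
  have bl: "bounded_linear (\<lambda>h. g t * D (x - t) h)" for x t
    using has_derivative_bounded_linear[OF D(1)] by (rule bounded_linear_const_mult)
  have fx: "blinfun_apply (fx x t) = (\<lambda>h. g t * D (x - t) h)" for x t
    unfolding fx_def using bl by (rule bounded_linear_Blinfun_apply)
  have cont_D: "continuous_on UNIV (\<lambda>x. D x h)" for h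
    using D(2) by (rule gauss_poly_continuous)
  have cont: "continuous_on (UNIV \<times> cbox a b) (\<lambda>(x, t). fx x t)"
    by (rule continuous_on_blinfun_componentwise)
      (auto simp: fx split_beta intro!: continuous_intros continuous_on_compose2[OF g]
        continuous_on_compose2[OF cont_D])
  have fx_int: "fx x integrable_on cbox a b" for x
    by (rule integrable_continuous) 
      (auto intro!: continuous_on_compose2[OF cont, where f = "\<lambda>t. (x, t)", simplified] continuous_intros)
  have "((\<lambda>x. integral (cbox a b) (\<lambda>t. g t * k (x - t))) has_derivative
           integral (cbox a b) (fx x)) (at x within UNIV)"
  proof (rule leibniz_rule)
    show "((\<lambda>x. g t * k (x - t)) has_derivative blinfun_apply (fx x t)) (at x within UNIV)" for x t
      unfolding fx
      by (intro has_derivative_mult_right)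
       (rule has_derivative_compose[of "\<lambda>x. x - t" "\<lambda>h. h", OF _ D(1)], auto intro!: derivative_eq_intros)
    show "(\<lambda>t. g t * k (x - t)) integrable_on cbox a b" for x
      by (intro integrable_continuous continuous_intros continuous_on_compose2[OF g]
          continuous_on_compose2[OF gauss_poly_continuous[OF k, of UNIV]]) auto
  qed (use cont in auto)
  also have "blinfun_apply (integral (cbox a b) (fx x)) =
      (\<lambda>h. integral (cbox a b) (\<lambda>t. g t * D (x - t) h))"
    by (rule ext) (simp add: blinfun_apply_integral[OF fx_int] fx)
  finally show ?thesis by simp
qed

lemma C_inf_gauss_convolution:
  fixes g :: "'a::euclidean_space \<Rightarrow> real"
  assumes g: "continuous_on UNIV g"
  shows "C_inf (\<lambda>x. c * integral (cbox a b) (\<lambda>t. g t * exp (- s * ((x - t) \<bullet> (x - t)))))"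
proof (rule C_inf_family)
  let ?S = "{\<lambda>x. integral (cbox a b) (\<lambda>t. g t * k (x - t)) | k. gauss_poly s k}"
  fix f assume "f \<in> ?S"
  then obtain k where k: "gauss_poly s k" and f: "f = (\<lambda>x. integral (cbox a b) (\<lambda>t. g t * k (x - t)))"
    by blast
  obtain D where D: "\<And>x. (k has_derivative D x) (at x)" "\<And>h. gauss_poly s (\<lambda>x. D x h)"
    using gauss_poly_derivative[OF k] by blast
  show "\<exists>D. (\<forall>x. (f has_derivative D x) (at x)) \<and> (\<forall>h. (\<lambda>x. D x h) \<in> ?S)"
  proof (intro exI[of _ "\<lambda>x h. integral (cbox a b) (\<lambda>t. g t * D (x - t) h)"] conjI allI)
    show "(f has_derivative (\<lambda>h. integral (cbox a b) (\<lambda>t. g t * D (x - t) h))) (at x)" for x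
      unfolding f by (rule gauss_poly_convolution_derivative[OF g k D])
    show "(\<lambda>x. integral (cbox a b) (\<lambda>t. g t * D (x - t) h)) \<in> ?S" for h
      by (rule CollectI) (rule exI[of _ "\<lambda>x. D x h"], simp add: D(2))
  qed
next
  have "gauss_poly s (\<lambda>x::'a. c * exp (- s * (x \<bullet> x)))"
    by (intro gauss_poly.intros)
  moreover have "(\<lambda>x. c * integral (cbox a b) (\<lambda>t. g t * exp (- s * ((x - t) \<bullet> (x - t)))))
      = (\<lambda>x. integral (cbox a b) (\<lambda>t. g t * (c * exp (- s * ((x - t) \<bullet> (x - t))))))"
    by (simp flip: integral_mult_right add: ac_simps)
  ultimately show "(\<lambda>x. c * integral (cbox a b) (\<lambda>t. g t * exp (- s * ((x - t) \<bullet> (x - t)))))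
      \<in> {\<lambda>x. integral (cbox a b) (\<lambda>t. g t * k (x - t)) | k. gauss_poly s k}"
    by (auto intro!: exI[of _ "\<lambda>x. c * exp (- s * (x \<bullet> x))"])
qed

section \<open>The Gaussian probability measure and convolution with it\<close>

definition gauss_mass :: "'a::euclidean_space itself \<Rightarrow> real" where
  "gauss_mass _ = (\<integral>x. exp (- ((x::'a) \<bullet> x)) \<partial>lborel)"

lemma integrable_gauss: "integrable lborel (\<lambda>x::'a::euclidean_space. exp (- (x \<bullet> x)))"
proof (rule integrableI_nonneg)
  let ?I = "\<integral>\<^sup>+y. ennreal (exp (- (y * y))) \<partial>lborel"
  \<comment> \<open>The function \<open>exp (- x\<^sup>2)\<close> is proportional to the normal
    density of variance 1/2; the integral over the whole space factors into such one-dimensional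
    integrals.\<close>
  have "(\<lambda>x::real. exp (- x\<^sup>2)) = (\<lambda>x. sqrt pi * normal_density 0 (1 / sqrt 2) x)"
    by (auto simp: normal_density_def power_divide)
  moreover have "integrable lborel (\<lambda>x. sqrt pi * normal_density 0 (1 / sqrt 2) x)"
    by (intro integrable_mult_right integrable_normal_density) simp
  ultimately have "integrable lborel (\<lambda>x::real. exp (- x\<^sup>2))"
    by simp
  then have fin: "?I < \<infinity>"
    by (simp add: integrable_iff_bounded power2_eq_square)
  have "exp (- (x \<bullet> x)) = (\<Prod>b\<in>Basis. exp (- ((x \<bullet> b) * (x \<bullet> b))))" for x :: 'a
    by (simp flip: exp_sum add: sum_negf) (simp add: euclidean_inner[of x x])
  then have "(\<integral>\<^sup>+x. ennreal (exp (- ((x::'a) \<bullet> x))) \<partial>lborel)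
      = (\<integral>\<^sup>+x. (\<Prod>b\<in>Basis. ennreal (exp (- (((x::'a) \<bullet> b) * (x \<bullet> b))))) \<partial>lborel)"
    by (simp add: prod_ennreal)
  also have "\<dots> = (\<Prod>b\<in>(Basis::'a set). ?I)"
    by (rule nn_integral_lborel_prod) auto
  also have "\<dots> < \<infinity>"
    using fin by (simp add: power_less_top_ennreal)
  finally show "(\<integral>\<^sup>+x. ennreal (exp (- ((x::'a) \<bullet> x))) \<partial>lborel) < \<infinity>" .
qed auto

definition gauss_measure :: "'a::euclidean_space measure" where
  "gauss_measure = density lborel (\<lambda>x. ennreal (exp (- (x \<bullet> x)) / gauss_mass TYPE('a)))"

lemma gauss_mass_pos: "gauss_mass TYPE('a::euclidean_space) > 0"
proof -
  have "gauss_mass TYPE('a) \<noteq> 0"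
  proof
    assume "gauss_mass TYPE('a) = 0"
    then have "AE x in lborel. exp (- ((x::'a) \<bullet> x)) = 0"
      unfolding gauss_mass_def
      by (subst (asm) integral_nonneg_eq_0_iff_AE) (auto intro: integrable_gauss)
    then have "AE x in (lborel::'a measure). False"
      by simp
    then show False
      by (simp add: ae_filter_eq_bot_iff flip: trivial_limit_def)
  qed
  moreover have "gauss_mass TYPE('a) \<ge> 0"
    by (simp add: gauss_mass_def)
  ultimately show ?thesis by simp
qed

lemma sets_gauss_measure [simp, measurable_cong]: "sets gauss_measure = sets borel"
  by (simp add: gauss_measure_def)

lemma prob_space_gauss_measure: "prob_space (gauss_measure :: 'a::euclidean_space measure)"
proof
  have "emeasure gauss_measure (space (gauss_measure :: 'a measure))
      = (\<integral>\<^sup>+x. ennreal (exp (- ((x::'a) \<bullet> x)) / gauss_mass TYPE('a)) \<partial>lborel)"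
    by (simp add: gauss_measure_def emeasure_density)
  also have "\<dots> = ennreal (\<integral>x. exp (- ((x::'a) \<bullet> x)) / gauss_mass TYPE('a) \<partial>lborel)"
    using gauss_mass_pos[where 'a='a]
    by (intro nn_integral_eq_integral integrable_divide integrable_gauss) auto
  also have "\<dots> = 1"
    using gauss_mass_pos[where 'a='a] by (simp add: gauss_mass_def)
  finally show "emeasure gauss_measure (space (gauss_measure :: 'a measure)) = 1" .
qed

text \<open>Substituting t = x - e z moves \<open>x\<close> from \<open>g\<close> to the Gaussian,
  at the cost of the Jacobian \<open>e ^ DIM('a)\<close>. The left-hand side averages translates of
  \<open>g\<close> and so preserves upper gradients; the right-hand side can be differentiated in
  \<open>x\<close>.\<close>

lemma gauss_mollifier_eq:
  fixes g :: "'a::euclidean_space \<Rightarrow> real"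
  assumes g: "continuous_on UNIV g" and supp: "\<And>x. x \<notin> cbox a b \<Longrightarrow> g x = 0" and e: "e > 0"
  shows "(\<integral>z. g (x - e *\<^sub>R z) \<partial>gauss_measure) =
    (1 / (gauss_mass TYPE('a) * e ^ DIM('a))) *
    integral (cbox a b) (\<lambda>t. g t * exp (- (1 / e\<^sup>2) * ((x - t) \<bullet> (x - t))))"
proof -
  have [measurable]: "g \<in> borel_measurable borel"
    using g by (rule borel_measurable_continuous_onI)
  define h where "h t = g t * exp (- (1 / e\<^sup>2) * ((x - t) \<bullet> (x - t)))" for t
  have h_cont: "continuous_on (cbox a b) h"
    unfolding h_def by (intro continuous_intros continuous_on_subset[OF g]) auto
  have [measurable]: "h \<in> borel_measurable borel"
    unfolding h_def by measurable
  have "integral (cbox a b) h = (\<integral>t. indicator (cbox a b) t *\<^sub>R h t \<partial>lborel)"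
    using set_borel_integral_eq_integral(2)[of "cbox a b" h] borel_integrable_compact[OF compact_cbox h_cont]
    by (simp add: set_integrable_def set_lebesgue_integral_def)
  also have "(\<lambda>t. indicator (cbox a b) t *\<^sub>R h t) = h"
    by (auto simp: h_def fun_eq_iff indicator_def supp)
  also have "(\<integral>t. h t \<partial>lborel) =
      (\<integral>t. h t \<partial>density (distr lborel borel (\<lambda>z. x + (- e) *\<^sub>R z)) (\<lambda>_. \<bar>- e\<bar> ^ DIM('a)))"
    using lborel_affine[of "- e" x] e by simp
  also have "\<dots> = e ^ DIM('a) * (\<integral>z. h (x - e *\<^sub>R z) \<partial>lborel)"
    using e by (simp add: integral_density integral_distr)
  also have "(\<lambda>z. h (x - e *\<^sub>R z)) = (\<lambda>z. g (x - e *\<^sub>R z) * exp (- (z \<bullet> z)))"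
    using e by (auto simp: h_def fun_eq_iff power2_eq_square)
  finally have *: "integral (cbox a b) h = e ^ DIM('a) * (\<integral>z. g (x - e *\<^sub>R z) * exp (- (z \<bullet> z)) \<partial>lborel)" .
  have "(\<integral>z. g (x - e *\<^sub>R z) \<partial>gauss_measure) =
      (\<integral>z. (g (x - e *\<^sub>R z) * exp (- (z \<bullet> z))) / gauss_mass TYPE('a) \<partial>lborel)"
    unfolding gauss_measure_def using gauss_mass_pos[where 'a='a]
    by (subst integral_density) (auto simp: less_imp_le mult.commute)
  also have "\<dots> = (\<integral>z. g (x - e *\<^sub>R z) * exp (- (z \<bullet> z)) \<partial>lborel) / gauss_mass TYPE('a)"
    by simp
  finally show ?thesis
    using e gauss_mass_pos[where 'a='a] unfolding h_def[symmetric] * by simp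
qed

lemma C_inf_gauss_mollifier:
  fixes g :: "'a::euclidean_space \<Rightarrow> real"
  assumes "continuous_on UNIV g" "\<And>x. x \<notin> cbox a b \<Longrightarrow> g x = 0" "e > 0"
  shows "C_inf (\<lambda>x. \<integral>z. g (x - e *\<^sub>R z) \<partial>gauss_measure)"
proof -
  have "(\<lambda>x. \<integral>z. g (x - e *\<^sub>R z) \<partial>gauss_measure) = (\<lambda>x. (1 / (gauss_mass TYPE('a) * e ^ DIM('a))) *
      integral (cbox a b) (\<lambda>t. g t * exp (- (1 / e\<^sup>2) * ((x - t) \<bullet> (x - t)))))"
    by (rule ext) (rule gauss_mollifier_eq[OF assms])
  then show ?thesis
    by (simp only:) (rule C_inf_gauss_convolution[OF assms(1)])
qed

section \<open>Upper gradients\<close>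

lemma prob_measuresD:
  assumes "m \<in> prob_measures"
  shows "prob_space m" "sets m = sets borel"
  using assms by (auto simp: space_prob_algebra)

lemma integrable_bounded:
  fixes f :: "'a::euclidean_space \<Rightarrow> real"
  assumes m: "m \<in> prob_measures" and f: "f \<in> borel_measurable borel" "\<And>x. \<bar>f x\<bar> \<le> K"
  shows "integrable m f"
proof -
  interpret prob_space m using prob_measuresD[OF m] by simp
  show ?thesis
    using f prob_measuresD(2)[OF m]
    by (intro integrable_const_bound[where B = K]) (auto cong: measurable_cong_sets)
qed

lemma abs_square_le: "\<bar>a\<bar> \<le> K \<Longrightarrow> a\<^sup>2 \<le> K\<^sup>2" for a K :: real
  by (metis abs_ge_zero power2_abs power_mono)

lemma abs_integral_le:
  fixes f :: "'a::euclidean_space \<Rightarrow> real"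
  assumes m: "m \<in> prob_measures" and f: "f \<in> borel_measurable borel" "\<And>x. \<bar>f x\<bar> \<le> K"
  shows "\<bar>\<integral>x. f x \<partial>m\<bar> \<le> K"
proof -
  interpret prob_space m using prob_measuresD[OF m] by simp
  have "\<bar>\<integral>x. f x \<partial>m\<bar> \<le> (\<integral>x. \<bar>f x\<bar> \<partial>m)" by (rule integral_abs_bound)
  also have "\<dots> \<le> (\<integral>x. K \<partial>m)"
    using integrable_bounded[OF m f] f by (intro integral_mono) auto
  finally show ?thesis by (simp add: prob_space)
qed

lemma Cauchy_Schwarz_integral:
  fixes f g :: "'a \<Rightarrow> real"
  assumes [measurable]: "f \<in> borel_measurable M" "g \<in> borel_measurable M"
    and f: "integrable M (\<lambda>x. (f x)\<^sup>2)" and g: "integrable M (\<lambda>x. (g x)\<^sup>2)"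
  shows "integrable M (\<lambda>x. f x * g x)"
    and "(\<integral>x. \<bar>f x * g x\<bar> \<partial>M)\<^sup>2 \<le> (\<integral>x. (f x)\<^sup>2 \<partial>M) * (\<integral>x. (g x)\<^sup>2 \<partial>M)"
proof -
  have "\<bar>f x * g x\<bar> \<le> (f x)\<^sup>2 + (g x)\<^sup>2" for x
    using sum_squares_bound[of "\<bar>f x\<bar>" "\<bar>g x\<bar>"] mult_nonneg_nonneg[of "\<bar>f x\<bar>" "\<bar>g x\<bar>"]
    unfolding abs_mult power2_abs mult.assoc by linarith
  then show int: "integrable M (\<lambda>x. f x * g x)"
    by (intro Bochner_Integration.integrable_bound[OF Bochner_Integration.integrable_add[OF f g]]) auto
  have "ennreal ((\<integral>x. \<bar>f x * g x\<bar> \<partial>M)\<^sup>2) = (\<integral>\<^sup>+x. ennreal \<bar>f x\<bar> * ennreal \<bar>g x\<bar> \<partial>M)\<^sup>2"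
    using nn_integral_eq_integral[OF integrable_abs[OF int]]
    by (simp flip: ennreal_mult ennreal_power add: abs_mult)
  also have "\<dots> \<le> (\<integral>\<^sup>+x. (ennreal \<bar>f x\<bar>)\<^sup>2 \<partial>M) * (\<integral>\<^sup>+x. (ennreal \<bar>g x\<bar>)\<^sup>2 \<partial>M)"
    by (rule Cauchy_Schwarz_nn_integral) auto
  also have "\<dots> = ennreal ((\<integral>x. (f x)\<^sup>2 \<partial>M) * (\<integral>x. (g x)\<^sup>2 \<partial>M))"
    using nn_integral_eq_integral[OF f] nn_integral_eq_integral[OF g]
    by (simp add: ennreal_power ennreal_mult)
  finally show "(\<integral>x. \<bar>f x * g x\<bar> \<partial>M)\<^sup>2 \<le> (\<integral>x. (f x)\<^sup>2 \<partial>M) * (\<integral>x. (g x)\<^sup>2 \<partial>M)"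
    by (subst (asm) ennreal_le_iff) auto
qed

text \<open>The function \<open>G\<close> plays the role of \<open>\<bar>\<nabla>g\<bar>\<close>, but \<open>g\<close> need not be differentiable:
  unlike the smooth functions, the class of such pairs is stable under Markov kernels that
  contract \<open>W2\<close> (see \<open>upgrad_kernel\<close>), and under mollification.\<close>
definition upgrad :: "real \<Rightarrow> ('a::euclidean_space \<Rightarrow> real) \<Rightarrow> ('a \<Rightarrow> real) \<Rightarrow> bool" where
  "upgrad K g G \<longleftrightarrow>
     (\<forall>x. \<bar>g x\<bar> \<le> K \<and> 0 \<le> G x \<and> G x \<le> K) \<and>
     (\<forall>x y. \<bar>G x - G y\<bar> \<le> K * dist x y \<and> \<bar>g x - g y\<bar> \<le> G x * dist x y + K * (dist x y)\<^sup>2)"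

text \<open>Here the constant may grow with the ball. This admits a smooth function together with
  the norm of its gradient (\<open>local_upgrad_grad\<close>), although neither need be bounded or
  globally Lipschitz.\<close>

definition local_upgrad :: "('a::euclidean_space \<Rightarrow> real) \<Rightarrow> ('a \<Rightarrow> real) \<Rightarrow> bool" where
  "local_upgrad g G \<longleftrightarrow>
     (\<forall>x. 0 \<le> G x) \<and>
     (\<forall>n. \<exists>K. \<forall>x\<in>cball 0 n. \<forall>y\<in>cball 0 n.
        \<bar>G x - G y\<bar> \<le> K * dist x y \<and> \<bar>g x - g y\<bar> \<le> G x * dist x y + K * (dist x y)\<^sup>2)"

lemma upgradD:
  assumes "upgrad K g G"
  shows "\<bar>g x\<bar> \<le> K" "0 \<le> G x" "G x \<le> K" "\<bar>G x - G y\<bar> \<le> K * dist x y"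
    "\<bar>g x - g y\<bar> \<le> G x * dist x y + K * (dist x y)\<^sup>2" "0 \<le> K" "\<bar>G x\<bar> \<le> K"
proof -
  show *: "\<bar>g x\<bar> \<le> K" "0 \<le> G x" "G x \<le> K" "\<bar>G x - G y\<bar> \<le> K * dist x y"
    "\<bar>g x - g y\<bar> \<le> G x * dist x y + K * (dist x y)\<^sup>2"
    using assms by (auto simp: upgrad_def)
  then show "0 \<le> K" "\<bar>G x\<bar> \<le> K" by auto
qed

lemma upgrad_imp_local_upgrad: "upgrad K g G \<Longrightarrow> local_upgrad g G"
  unfolding upgrad_def local_upgrad_def by blast

lemma local_upgrad_continuous:
  assumes "local_upgrad g G"
  shows "continuous_on UNIV g" "continuous_on UNIV G"
proof -
  have "isCont g x \<and> isCont G x" for x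
  proof -
    obtain K where K: "\<And>y z. y \<in> cball 0 (norm x + 1) \<Longrightarrow> z \<in> cball 0 (norm x + 1) \<Longrightarrow>
        \<bar>G y - G z\<bar> \<le> K * dist y z \<and> \<bar>g y - g z\<bar> \<le> G y * dist y z + K * (dist y z)\<^sup>2"
      using assms unfolding local_upgrad_def by metis
    have "\<forall>\<^sub>F y in at x. dist y x < 1"
      by (rule eventually_at_ball'[of 1 x UNIV, THEN eventually_mono]) (auto simp: dist_commute)
    then have ev: "\<forall>\<^sub>F y in at x. y \<in> cball 0 (norm x + 1)"
    proof eventually_elim
      case (elim y)
      then show ?case
        using norm_triangle_sub[of y x] by (simp add: dist_norm)
    qed
    have x: "x \<in> cball 0 (norm x + 1)" by simp
    have g_ev: "\<forall>\<^sub>F y in at x. dist (g y) (g x) \<le> G x * dist x y + K * (dist x y)\<^sup>2"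
      using ev by eventually_elim (use K[OF x] in \<open>auto simp: dist_real_def abs_minus_commute\<close>)
    have G_ev: "\<forall>\<^sub>F y in at x. dist (G y) (G x) \<le> K * dist x y"
      using ev by eventually_elim (use K[OF x] in \<open>auto simp: dist_real_def abs_minus_commute\<close>)
    have d: "((\<lambda>y. dist x y) \<longlongrightarrow> dist x x) (at x)"
      by (intro tendsto_intros)
    have "((\<lambda>y. G x * dist x y + K * (dist x y)\<^sup>2) \<longlongrightarrow> G x * dist x x + K * (dist x x)\<^sup>2) (at x)"
      by (intro tendsto_intros d)
    then have g_lim: "((\<lambda>y. G x * dist x y + K * (dist x y)\<^sup>2) \<longlongrightarrow> 0) (at x)"
      by simp
    have G_lim: "((\<lambda>y. K * dist x y) \<longlongrightarrow> 0) (at x)"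
      using tendsto_mult_left[OF d, of K] by simp
    have "isCont g x"
      unfolding isCont_def tendsto_dist_iff[of g]
      by (rule tendsto_sandwich[OF _ g_ev tendsto_const g_lim]) simp
    have "isCont G x"
      unfolding isCont_def tendsto_dist_iff[of G]
      by (rule tendsto_sandwich[OF _ G_ev tendsto_const G_lim]) simp
    with \<open>isCont g x\<close> show ?thesis by simp
  qed
  then show "continuous_on UNIV g" "continuous_on UNIV G"
    by (auto intro: continuous_at_imp_continuous_on)
qed

lemmas upgrad_continuous = local_upgrad_continuous[OF upgrad_imp_local_upgrad]
lemmas local_upgrad_measurable = local_upgrad_continuous[THEN borel_measurable_continuous_onI]
lemmas upgrad_measurable = upgrad_continuous[THEN borel_measurable_continuous_onI]

text \<open>The difference quotient of \<open>f\<close> along its own gradient tends to the squared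
  norm of that gradient, while the quadratic term disappears in the limit.\<close>

lemma norm_grad_le:
  fixes f :: "'a::euclidean_space \<Rightarrow> real"
  assumes f: "f differentiable (at x)" and le: "\<And>y. \<bar>f x - f y\<bar> \<le> a * dist x y + K * (dist x y)\<^sup>2"
  shows "norm (grad f x) \<le> a"
proof (cases "grad f x = 0")
  \<comment> \<open>What remains is \<open>0 \<le> a\<close>, which is not a hypothesis: the
    right-hand side of \<open>le\<close> bounds an absolute value, and dividing it by a distance
    \<open>t\<close> that tends to 0 leaves \<open>a\<close>.\<close>
  case True
  obtain b :: 'a where "b \<in> Basis" using nonempty_Basis by blast
  have nonneg': "0 \<le> a * t + K * t\<^sup>2" if "t > 0" for t
    using le[of "x + t *\<^sub>R b"] that \<open>b \<in> Basis\<close> by (simp add: dist_norm)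
  have nonneg: "0 \<le> a + K * t" if "0 < t" for t
  proof -
    have "a * t + K * t\<^sup>2 = t * (a + K * t)"
      by (simp add: power2_eq_square algebra_simps)
    with nonneg'[OF that] that show ?thesis
      by (simp add: zero_le_mult_iff)
  qed
  have "\<forall>\<^sub>F t in at_right 0. 0 \<le> a + K * t"
    by (rule eventually_mono[OF eventually_at_right_less]) (rule nonneg)
  moreover have "((\<lambda>t. a + K * t) \<longlongrightarrow> a + K * 0) (at_right 0)"
    by (intro tendsto_intros)
  ultimately show ?thesis
    using True tendsto_lowerbound[of "\<lambda>t. a + K * t" a "at_right 0" 0] by simp
next
  case False
  define u where "u = grad f x"
  have D: "(f has_derivative (\<lambda>h. h \<bullet> u)) (at x)"
    using GDERIV_grad[OF f] by (simp add: gderiv_def u_def)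
  have "((\<lambda>t::real. f (x + t *\<^sub>R u)) has_derivative (\<lambda>t. (t *\<^sub>R u) \<bullet> u)) (at 0)"
    by (rule has_derivative_compose[of "\<lambda>t. x + t *\<^sub>R u" "\<lambda>t. t *\<^sub>R u" 0 UNIV f])
      (use D in \<open>auto intro!: derivative_eq_intros\<close>)
  then have "((\<lambda>t::real. f (x + t *\<^sub>R u)) has_real_derivative u \<bullet> u) (at 0)"
    by (simp add: has_field_derivative_def mult.commute[of _ "u \<bullet> u"] mult_commute_abs)
  then have lim: "((\<lambda>t. (f (x + t *\<^sub>R u) - f x) / t) \<longlongrightarrow> u \<bullet> u) (at_right 0)"
    unfolding DERIV_def by (simp add: filterlim_at_split)
  have quot: "(f (x + t *\<^sub>R u) - f x) / t \<le> a * norm u + K * t * (norm u)\<^sup>2" if "0 < t" for t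
  proof -
    have "f (x + t *\<^sub>R u) - f x \<le> t * (a * norm u + K * t * (norm u)\<^sup>2)"
      using le[of "x + t *\<^sub>R u"] that by (simp add: dist_norm algebra_simps power2_eq_square)
    with that show ?thesis by (simp add: divide_le_eq mult.commute)
  qed
  have "\<forall>\<^sub>F t in at_right 0. (f (x + t *\<^sub>R u) - f x) / t \<le> a * norm u + K * t * (norm u)\<^sup>2"
    by (rule eventually_mono[OF eventually_at_right_less]) (rule quot)
  moreover have "((\<lambda>t. a * norm u + K * t * (norm u)\<^sup>2) \<longlongrightarrow> a * norm u + K * 0 * (norm u)\<^sup>2) (at_right 0)"
    by (intro tendsto_intros)
  ultimately have "u \<bullet> u \<le> a * norm u"
    using tendsto_le[OF _ _ lim] by simp
  moreover have "norm u > 0" using False by (simp add: u_def)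
  ultimately show ?thesis
    by (simp add: u_def[symmetric] dot_square_norm power2_eq_square)
qed

lemma prob_measures_gauss_measure: "gauss_measure \<in> prob_measures"
  by (simp add: space_prob_algebra prob_space_gauss_measure)

text \<open>The conditions are invariant under translation and survive averaging. The constant
  \<open>K\<close> does not depend on \<open>e\<close>, which provides the uniform bounds when
  \<open>e\<close> tends to 0.\<close>

lemma upgrad_mollify:
  fixes g G :: "'a::euclidean_space \<Rightarrow> real"
  assumes "upgrad K g G"
  shows "upgrad K (\<lambda>x. \<integral>z. g (x - e *\<^sub>R z) \<partial>gauss_measure) (\<lambda>x. \<integral>z. G (x - e *\<^sub>R z) \<partial>gauss_measure)"
proof -
  note D = upgradD[OF assms]
  note [measurable] = upgrad_measurable[OF assms]
  interpret prob_space "gauss_measure :: 'a measure" by (rule prob_space_gauss_measure)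
  have int_g: "integrable gauss_measure (\<lambda>z. g (x - e *\<^sub>R z))" for x
    by (rule integrable_bounded[OF prob_measures_gauss_measure, of _ K]) (auto intro: D)
  have int_G: "integrable gauss_measure (\<lambda>z. G (x - e *\<^sub>R z))" for x
    by (rule integrable_bounded[OF prob_measures_gauss_measure, of _ K]) (auto intro: D)
  have D4: "\<bar>G (x - e *\<^sub>R z) - G (y - e *\<^sub>R z)\<bar> \<le> K * dist x y" for x y z
    using D(4)[of "x - e *\<^sub>R z" "y - e *\<^sub>R z"] by (simp add: dist_norm)
  have D5: "\<bar>g (x - e *\<^sub>R z) - g (y - e *\<^sub>R z)\<bar> \<le> G (x - e *\<^sub>R z) * dist x y + K * (dist x y)\<^sup>2" for x y z
    using D(5)[of "x - e *\<^sub>R z" "y - e *\<^sub>R z"] by (simp add: dist_norm)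
  have "\<bar>\<integral>z. g (x - e *\<^sub>R z) \<partial>gauss_measure\<bar> \<le> K" for x
    by (rule abs_integral_le[OF prob_measures_gauss_measure]) (auto intro: D)
  moreover have "(\<integral>z. G (x - e *\<^sub>R z) \<partial>gauss_measure) \<le> K" for x
    by (rule order_trans[OF abs_ge_self])
      (rule abs_integral_le[OF prob_measures_gauss_measure], auto intro: D)
  moreover have "0 \<le> (\<integral>z. G (x - e *\<^sub>R z) \<partial>gauss_measure)" for x
    by (simp add: D)
  moreover have "\<bar>(\<integral>z. G (x - e *\<^sub>R z) \<partial>gauss_measure) - (\<integral>z. G (y - e *\<^sub>R z) \<partial>gauss_measure)\<bar>
      \<le> K * dist x y" for x y
  proof -
    have "\<bar>\<integral>z. G (x - e *\<^sub>R z) - G (y - e *\<^sub>R z) \<partial>gauss_measure\<bar> \<le> K * dist x y"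
      by (rule abs_integral_le[OF prob_measures_gauss_measure])
        (auto intro: D4)
    then show ?thesis
      by (simp add: int_G)
  qed
  moreover have "\<bar>(\<integral>z. g (x - e *\<^sub>R z) \<partial>gauss_measure) - (\<integral>z. g (y - e *\<^sub>R z) \<partial>gauss_measure)\<bar>
      \<le> (\<integral>z. G (x - e *\<^sub>R z) \<partial>gauss_measure) * dist x y + K * (dist x y)\<^sup>2" for x y
  proof -
    have "\<bar>(\<integral>z. g (x - e *\<^sub>R z) \<partial>gauss_measure) - (\<integral>z. g (y - e *\<^sub>R z) \<partial>gauss_measure)\<bar>
      = \<bar>\<integral>z. g (x - e *\<^sub>R z) - g (y - e *\<^sub>R z) \<partial>gauss_measure\<bar>"
      by (simp add: int_g)
    also have "\<dots> \<le> (\<integral>z. \<bar>g (x - e *\<^sub>R z) - g (y - e *\<^sub>R z)\<bar> \<partial>gauss_measure)"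
      by (rule integral_abs_bound)
    also have "\<dots> \<le> (\<integral>z. G (x - e *\<^sub>R z) * dist x y + K * (dist x y)\<^sup>2 \<partial>gauss_measure)"
      using int_g int_G by (intro integral_mono) (auto intro: D5)
    also have "\<dots> = (\<integral>z. G (x - e *\<^sub>R z) \<partial>gauss_measure) * dist x y + K * (dist x y)\<^sup>2"
      using int_G by (simp add: prob_space)
    finally show ?thesis .
  qed
  ultimately show ?thesis
    unfolding upgrad_def by blast
qed

lemma mollify_tendsto:
  fixes h :: "'a::euclidean_space \<Rightarrow> real"
  assumes h: "continuous_on UNIV h" "\<And>x. \<bar>h x\<bar> \<le> K" and e: "e \<longlonglongrightarrow> 0"
  shows "(\<lambda>n. \<integral>z. h (x - e n *\<^sub>R z) \<partial>gauss_measure) \<longlonglongrightarrow> h x"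
proof -
  interpret prob_space "gauss_measure :: 'a measure" by (rule prob_space_gauss_measure)
  have [measurable]: "h \<in> borel_measurable borel"
    using h(1) by (rule borel_measurable_continuous_onI)
  have "(\<lambda>n. \<integral>z. h (x - e n *\<^sub>R z) \<partial>gauss_measure) \<longlonglongrightarrow> (\<integral>z. h x \<partial>(gauss_measure :: 'a measure))"
  proof (rule integral_dominated_convergence[where w = "\<lambda>_. K" and f = "\<lambda>_. h x"])
    have "(\<lambda>n. x - e n *\<^sub>R z) \<longlonglongrightarrow> x - 0 *\<^sub>R z" for z
      by (intro tendsto_intros e)
    then have "(\<lambda>n. h (x - e n *\<^sub>R z)) \<longlonglongrightarrow> h (x - 0 *\<^sub>R z)" for z
      by (rule continuous_on_tendsto_compose[OF h(1)]) auto
    then show "AE z in gauss_measure. (\<lambda>n. h (x - e n *\<^sub>R z)) \<longlonglongrightarrow> h x"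
      by simp
  qed (auto simp: h(2))
  then show ?thesis by (simp add: prob_space)
qed

lemma integral_square_tendsto:
  fixes u :: "nat \<Rightarrow> 'a::euclidean_space \<Rightarrow> real"
  assumes m: "m \<in> prob_measures" and u: "\<And>n. u n \<in> borel_measurable borel" "\<And>n x. \<bar>u n x\<bar> \<le> K"
    and lim: "\<And>x. (\<lambda>n. u n x) \<longlonglongrightarrow> h x" and h: "h \<in> borel_measurable borel"
  shows "(\<lambda>n. \<integral>x. (u n x)\<^sup>2 \<partial>m) \<longlonglongrightarrow> (\<integral>x. (h x)\<^sup>2 \<partial>m)" "(\<lambda>n. \<integral>x. u n x \<partial>m) \<longlonglongrightarrow> (\<integral>x. h x \<partial>m)"
proof -
  interpret prob_space m using prob_measuresD[OF m] by simp
  have [measurable_cong]: "sets m = sets borel" using prob_measuresD[OF m] by simp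
  note [measurable] = u(1) h
  have "(u n x)\<^sup>2 \<le> K\<^sup>2" for n x
    using u(2)[of n x] by (simp add: abs_le_square_iff[symmetric])
  then show "(\<lambda>n. \<integral>x. (u n x)\<^sup>2 \<partial>m) \<longlonglongrightarrow> (\<integral>x. (h x)\<^sup>2 \<partial>m)"
    by (intro integral_dominated_convergence[where w = "\<lambda>_. K\<^sup>2"]) (auto intro!: tendsto_power lim)
  show "(\<lambda>n. \<integral>x. u n x \<partial>m) \<longlonglongrightarrow> (\<integral>x. h x \<partial>m)"
    by (intro integral_dominated_convergence[where w = "\<lambda>_. K"]) (auto intro!: lim simp: u)
qed

lemma poincare_bounded:
  fixes f :: "'a::euclidean_space \<Rightarrow> real"
  assumes m: "m \<in> prob_measures" and P: "poincare m C" and C: "0 \<le> C"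
    and f: "C_inf f" "upgrad K f F"
  shows "(\<integral>x. (f x)\<^sup>2 \<partial>m) - (\<integral>x. f x \<partial>m)\<^sup>2 \<le> C * (\<integral>x. (F x)\<^sup>2 \<partial>m)"
proof -
  note D = upgradD[OF f(2)]
  note [measurable] = upgrad_measurable[OF f(2)]
  have "poly_growth f"
    unfolding poly_growth_def using D(1) by (intro exI[of _ K] exI[of _ 0]) simp
  then have *: "enn2ereal (\<integral>\<^sup>+ x. ennreal ((f x)\<^sup>2) \<partial>m) - ereal ((\<integral> x. f x \<partial>m)\<^sup>2)
          \<le> ereal C * enn2ereal (\<integral>\<^sup>+ x. ennreal ((norm (grad f x))\<^sup>2) \<partial>m)"
    using P f by (simp add: poincare_def)
  have "integrable m (\<lambda>x. (f x)\<^sup>2)"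
    by (rule integrable_bounded[OF m, of _ "K\<^sup>2"]) (auto intro: abs_square_le D)
  then have 1: "(\<integral>\<^sup>+ x. ennreal ((f x)\<^sup>2) \<partial>m) = ennreal (\<integral>x. (f x)\<^sup>2 \<partial>m)"
    by (rule nn_integral_eq_integral) simp
  have "integrable m (\<lambda>x. (F x)\<^sup>2)"
    by (rule integrable_bounded[OF m, of _ "K\<^sup>2"]) (auto intro: abs_square_le D)
  then have 2: "(\<integral>\<^sup>+ x. ennreal ((F x)\<^sup>2) \<partial>m) = ennreal (\<integral>x. (F x)\<^sup>2 \<partial>m)"
    by (rule nn_integral_eq_integral) simp
  have "C_diff (Suc 0) f"
    using f(1) unfolding C_inf_def by blast
  then have "f differentiable (at x)" for x
    by simp
  then have "norm (grad f x) \<le> F x" for x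
    using D(5) by (rule norm_grad_le)
  then have "(\<integral>\<^sup>+ x. ennreal ((norm (grad f x))\<^sup>2) \<partial>m) \<le> (\<integral>\<^sup>+ x. ennreal ((F x)\<^sup>2) \<partial>m)"
    by (intro nn_integral_mono ennreal_leI power_mono) auto
  then have "ereal C * enn2ereal (\<integral>\<^sup>+ x. ennreal ((norm (grad f x))\<^sup>2) \<partial>m)
      \<le> ereal C * enn2ereal (\<integral>\<^sup>+ x. ennreal ((F x)\<^sup>2) \<partial>m)"
    using C by (intro ereal_mult_left_mono) (auto simp: less_eq_ennreal.rep_eq)
  with * have "enn2ereal (\<integral>\<^sup>+ x. ennreal ((f x)\<^sup>2) \<partial>m) - ereal ((\<integral> x. f x \<partial>m)\<^sup>2)
      \<le> ereal C * enn2ereal (\<integral>\<^sup>+ x. ennreal ((F x)\<^sup>2) \<partial>m)"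
    by (rule order_trans)
  then show ?thesis
    unfolding 1 2 by (simp add: enn2ereal_ennreal)
qed

text \<open>Compact support of \<open>g\<close> makes its mollifications smooth by
  \<open>C_inf_gauss_mollifier\<close>. They no longer have compact support, but they stay bounded
  by \<open>K\<close>, which gives polynomial growth and dominates the limit on both sides.\<close>

lemma poincare_compact_support:
  fixes g G :: "'a::euclidean_space \<Rightarrow> real"
  assumes m: "m \<in> prob_measures" and P: "poincare m C" and C: "0 \<le> C"
    and g: "upgrad K g G" and supp: "\<And>x. norm x > r \<Longrightarrow> g x = 0"
  shows "(\<integral>x. (g x)\<^sup>2 \<partial>m) - (\<integral>x. g x \<partial>m)\<^sup>2 \<le> C * (\<integral>x. (G x)\<^sup>2 \<partial>m)"
proof -
  define e :: "nat \<Rightarrow> real" where "e n = 1 / real (Suc n)" for n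
  have e: "e n > 0" for n by (simp add: e_def)
  have e_lim: "e \<longlonglongrightarrow> 0"
    unfolding e_def by (rule LIMSEQ_Suc) (rule lim_1_over_n)
  define u where "u n x = (\<integral>z. g (x - e n *\<^sub>R z) \<partial>gauss_measure)" for n x
  define U where "U n x = (\<integral>z. G (x - e n *\<^sub>R z) \<partial>gauss_measure)" for n x
  have uU: "upgrad K (u n) (U n)" for n
    unfolding u_def U_def by (rule upgrad_mollify[OF g])
  obtain a b where "cball (0::'a) r \<subseteq> cbox a b"
    using bounded_subset_cbox_symmetric[OF bounded_cball] by metis
  then have supp': "g x = 0" if "x \<notin> cbox a b" for x
  proof -
    have "x \<notin> cball 0 r" using that \<open>cball 0 r \<subseteq> cbox a b\<close> by blast
    then show ?thesis by (intro supp) simp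
  qed
  have "C_inf (u n)" for n
    unfolding u_def by (rule C_inf_gauss_mollifier[OF upgrad_continuous(1)[OF g] supp' e])
  then have le: "(\<integral>x. (u n x)\<^sup>2 \<partial>m) - (\<integral>x. u n x \<partial>m)\<^sup>2 \<le> C * (\<integral>x. (U n x)\<^sup>2 \<partial>m)" for n
    using poincare_bounded[OF m P C _ uU] by blast
  have u_lim: "(\<lambda>n. u n x) \<longlonglongrightarrow> g x" and U_lim: "(\<lambda>n. U n x) \<longlonglongrightarrow> G x" for x
    unfolding u_def U_def
    by (rule mollify_tendsto[OF _ _ e_lim]; rule upgrad_continuous[OF g] upgradD(1,7)[OF g])+
  note u_meas = upgrad_measurable[OF uU] and g_meas = upgrad_measurable[OF g]
  show ?thesis
  proof (rule LIMSEQ_le)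
    show "(\<lambda>n. (\<integral>x. (u n x)\<^sup>2 \<partial>m) - (\<integral>x. u n x \<partial>m)\<^sup>2) \<longlonglongrightarrow> (\<integral>x. (g x)\<^sup>2 \<partial>m) - (\<integral>x. g x \<partial>m)\<^sup>2"
      by (intro tendsto_intros integral_square_tendsto[where K = K] m u_meas upgradD(1)[OF uU] u_lim g_meas)
    show "(\<lambda>n. C * (\<integral>x. (U n x)\<^sup>2 \<partial>m)) \<longlonglongrightarrow> C * (\<integral>x. (G x)\<^sup>2 \<partial>m)"
      by (intro tendsto_intros integral_square_tendsto[where K = K] m u_meas upgradD(7)[OF uU] U_lim g_meas)
  qed (use le in auto)
qed

section \<open>Transfer of the Poincare inequality by cutoffs\<close>

text \<open>For \<open>n = 0\<close> the division by zero makes this function constantly 1. Hence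
  the hypothesis \<open>n > 0\<close> in \<open>cutoff_eq_0\<close> and the shift to
  \<open>Suc n\<close> in \<open>poincare_local_upgrad\<close>.\<close>

definition cutoff :: "nat \<Rightarrow> 'a::euclidean_space \<Rightarrow> real" where
  "cutoff n x = max 0 (1 - norm x / real n)"

text \<open>The level \<open>sqrt n\<close> of the truncation tends to infinity slowly enough for the gradient
  of the cutoff, which is at most \<open>1 / n\<close>, to contribute only \<open>sqrt n / n \<longlonglongrightarrow> 0\<close>.\<close>
definition clamp_cutoff :: "nat \<Rightarrow> ('a::euclidean_space \<Rightarrow> real) \<Rightarrow> 'a \<Rightarrow> real" where
  "clamp_cutoff n g x = cutoff n x * max (- sqrt n) (min (sqrt n) (g x))"

text \<open>This is the product rule for \<open>clamp_cutoff\<close>: clamping does not increase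
  slopes, so the first summand is the cutoff times the slope \<open>G\<close>.\<close>

definition cutoff_upgrad :: "nat \<Rightarrow> ('a::euclidean_space \<Rightarrow> real) \<Rightarrow> 'a \<Rightarrow> real" where
  "cutoff_upgrad n G x = cutoff n x * G x + sqrt n / n"

lemma cutoff_bounds: "0 \<le> cutoff n x" "cutoff n x \<le> 1"
  by (auto simp: cutoff_def)

lemma cutoff_eq_0: "n > 0 \<Longrightarrow> norm x \<ge> n \<Longrightarrow> cutoff n x = 0"
  by (simp add: cutoff_def field_simps)

lemma cutoff_lipschitz: "\<bar>cutoff n x - cutoff n y\<bar> \<le> dist x y / n"
proof -
  have "\<bar>cutoff n x - cutoff n y\<bar> \<le> \<bar>norm x / n - norm y / n\<bar>"
    by (simp add: cutoff_def)
  also have "\<dots> = \<bar>norm x - norm y\<bar> / n"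
    by (simp add: diff_divide_distrib[symmetric])
  also have "\<dots> \<le> dist x y / n"
    by (intro divide_right_mono) (auto simp: dist_norm norm_triangle_ineq3)
  finally show ?thesis .
qed

lemma cutoff_tendsto_1: "(\<lambda>n. cutoff n x) \<longlonglongrightarrow> 1"
proof -
  have "(\<lambda>n. max 0 (1 - norm x / real n)) \<longlonglongrightarrow> max 0 (1 - 0)"
    by (intro tendsto_intros)
  then show ?thesis by (simp add: cutoff_def)
qed

lemma clamp_cutoff_tendsto: "(\<lambda>n. clamp_cutoff n g x) \<longlonglongrightarrow> g x"
proof -
  have "\<forall>\<^sub>F n in sequentially. \<bar>g x\<bar> \<le> sqrt (real n)"
    by real_asymp
  then have "\<forall>\<^sub>F n in sequentially. clamp_cutoff n g x = cutoff n x * g x"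
    by eventually_elim (auto simp: clamp_cutoff_def max_def min_def)
  moreover have "(\<lambda>n. cutoff n x * g x) \<longlonglongrightarrow> 1 * g x"
    by (intro tendsto_intros cutoff_tendsto_1)
  ultimately show ?thesis
    by (simp add: tendsto_cong)
qed

lemma abs_clamp_cutoff_le: "\<bar>clamp_cutoff n g x\<bar> \<le> \<bar>g x\<bar>" "\<bar>clamp_cutoff n g x\<bar> \<le> sqrt n"
proof -
  have "\<bar>clamp_cutoff n g x\<bar> \<le> 1 * \<bar>max (- sqrt n) (min (sqrt n) (g x))\<bar>"
    unfolding clamp_cutoff_def abs_mult using cutoff_bounds[of n x]
    by (intro mult_right_mono) auto
  moreover have "\<bar>max (- sqrt n) (min (sqrt n) (g x))\<bar> \<le> \<bar>g x\<bar>" "\<bar>max (- sqrt n) (min (sqrt n) (g x))\<bar> \<le> sqrt n"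
    using real_sqrt_ge_zero[of "real n"] by (auto simp: max_def min_def)
  ultimately show "\<bar>clamp_cutoff n g x\<bar> \<le> \<bar>g x\<bar>" "\<bar>clamp_cutoff n g x\<bar> \<le> sqrt n"
    by linarith+
qed

lemma cutoff_upgrad_tendsto: "(\<lambda>n. cutoff_upgrad n G x) \<longlonglongrightarrow> G x"
proof -
  have "(\<lambda>n. sqrt (real n) / real n) \<longlonglongrightarrow> 0" by real_asymp
  then have "(\<lambda>n. cutoff_upgrad n G x) \<longlonglongrightarrow> 1 * G x + 0"
    unfolding cutoff_upgrad_def by (intro tendsto_intros cutoff_tendsto_1)
  then show ?thesis by simp
qed

text \<open>The bound \<open>G x + 1\<close> is uniform in \<open>n\<close> and yields the
  dominating function for the squares in \<open>poincare_local_upgrad\<close>.\<close>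

lemma cutoff_upgrad_bounds:
  assumes "0 \<le> G x"
  shows "0 \<le> cutoff_upgrad n G x" "cutoff_upgrad n G x \<le> G x + 1"
proof -
  have "cutoff n x * G x \<le> 1 * G x"
    using cutoff_bounds assms by (intro mult_right_mono) auto
  moreover have "sqrt n \<le> n"
    by (cases "n = 0") (auto intro!: real_le_lsqrt simp: power2_eq_square)
  then have "sqrt n / n \<le> 1" by (simp add: divide_le_eq)
  ultimately show "cutoff_upgrad n G x \<le> G x + 1"
    by (simp add: cutoff_upgrad_def)
  show "0 \<le> cutoff_upgrad n G x"
    unfolding cutoff_upgrad_def using cutoff_bounds(1)[of n x] assms
    by (intro add_nonneg_nonneg mult_nonneg_nonneg) auto
qed

text \<open>The cutoff vanishes outside the ball of radius \<open>n\<close>, so the constant of that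
  ball becomes a global one. The delicate case is a pair of points on both sides of the boundary,
  where \<open>local_upgrad\<close> is not applied to compare their values and only the slope of the
  cutoff helps.\<close>

lemma upgrad_clamp_cutoff:
  fixes g G :: "'a::euclidean_space \<Rightarrow> real"
  assumes "local_upgrad g G" and n: "n > 0"
  shows "\<exists>K. upgrad K (clamp_cutoff n g) (cutoff_upgrad n G)"
proof -
  define c where "c x = max (- sqrt n) (min (sqrt n) (g x))" for x
  have cc: "clamp_cutoff n g x = cutoff n x * c x" for x
    by (simp add: clamp_cutoff_def c_def)
  have nonneg: "0 \<le> G x" for x
    using assms by (simp add: local_upgrad_def)
  obtain L' where L': "\<bar>G x - G y\<bar> \<le> L' * dist x y \<and> \<bar>g x - g y\<bar> \<le> G x * dist x y + L' * (dist x y)\<^sup>2"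
    if "x \<in> cball 0 n" "y \<in> cball 0 n" for x y
    using assms(1) unfolding local_upgrad_def by metis
  define L where "L = max L' 0"
  have L0: "0 \<le> L" by (simp add: L_def)
  have L: "\<bar>G x - G y\<bar> \<le> L * dist x y" "\<bar>g x - g y\<bar> \<le> G x * dist x y + L * (dist x y)\<^sup>2"
    if "x \<in> cball 0 n" "y \<in> cball 0 n" for x y
    using L'[OF that] mult_right_mono[of L' L "dist x y"] mult_right_mono[of L' L "(dist x y)\<^sup>2"]
    by (auto simp: L_def)
  define B where "B = G 0 + L * n"
  have B: "G x \<le> B" if "x \<in> cball 0 n" for x
  proof -
    have "G x \<le> G 0 + L * dist x 0"
      using L(1)[of x 0] that by simp
    also have "\<dots> \<le> B"
      using that L0 by (auto simp: B_def intro!: mult_left_mono)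
    finally show ?thesis .
  qed
  have B0: "0 \<le> B" using L0 nonneg by (simp add: B_def)
  \<comment> \<open>One constant has to serve as bound of the function, bound and Lipschitz constant
    of its upper gradient, and coefficient of the remainder. A sum of nonnegative terms dominates
    each of these demands.\<close>
  define K where "K = (sqrt n + sqrt n / n) + (L + B / n + B)"
  have K: "0 \<le> K" "sqrt n \<le> K" "B + sqrt n / n \<le> K" "L + B / n \<le> K" "L \<le> K" "B / n \<le> K"
    using B0 L0 by (auto simp: K_def)
  have zero: "cutoff n x = 0" if "x \<notin> cball 0 n" for x
    using that n by (intro cutoff_eq_0) auto
  have c_bound: "\<bar>c x\<bar> \<le> sqrt n" for x
    using real_sqrt_ge_zero[of "real n"] by (auto simp: c_def max_def min_def)
  have cG: "\<bar>cutoff n x * G x\<bar> \<le> B" for x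
  proof (cases "x \<in> cball 0 n")
    case True
    have "\<bar>cutoff n x * G x\<bar> = cutoff n x * G x"
      using cutoff_bounds(1)[of n x] nonneg[of x] by simp
    also have "\<dots> \<le> 1 * B"
      using cutoff_bounds[of n x] nonneg[of x] B[OF True] by (intro mult_mono) auto
    finally show ?thesis by simp
  qed (simp add: zero B0)
  have lip_G: "\<bar>cutoff n x * G x - cutoff n y * G y\<bar> \<le> K * dist x y" for x y
  proof -
    have half: "\<bar>cutoff n x * G x - cutoff n y * G y\<bar> \<le> B / n * dist x y" if "x \<in> cball 0 n" "y \<notin> cball 0 n" for x y
    proof -
      have "\<bar>cutoff n x * G x - cutoff n y * G y\<bar> = \<bar>cutoff n x - cutoff n y\<bar> * G x"
        using zero[OF that(2)] nonneg[of x] by (simp add: abs_mult)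
      also have "\<dots> \<le> (dist x y / n) * B"
        using cutoff_lipschitz[of n x y] B[OF that(1)] nonneg[of x] by (intro mult_mono) auto
      finally show ?thesis by (simp add: mult.commute)
    qed
    have full: "\<bar>cutoff n x * G x - cutoff n y * G y\<bar> \<le> (L + B / n) * dist x y" if "x \<in> cball 0 n" "y \<in> cball 0 n"
    proof -
      have "\<bar>cutoff n x * G x - cutoff n y * G y\<bar> = \<bar>cutoff n x * (G x - G y) + (cutoff n x - cutoff n y) * G y\<bar>"
        by (simp add: algebra_simps)
      also have "\<dots> \<le> \<bar>cutoff n x\<bar> * \<bar>G x - G y\<bar> + \<bar>cutoff n x - cutoff n y\<bar> * \<bar>G y\<bar>"
        by (metis abs_mult abs_triangle_ineq)
      also have "\<dots> \<le> 1 * (L * dist x y) + (dist x y / n) * B"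
        using cutoff_bounds[of n x] L(1)[OF that] cutoff_lipschitz[of n x y] B[OF that(2)] nonneg[of y]
        by (intro add_mono mult_mono) auto
      finally show ?thesis by (simp add: algebra_simps)
    qed
    have le: "a * dist x y \<le> K * dist x y" if "a \<le> K" for a
      using that by (rule mult_right_mono) simp
    consider "x \<in> cball 0 n" "y \<in> cball 0 n" | "x \<in> cball 0 n" "y \<notin> cball 0 n"
      | "x \<notin> cball 0 n" "y \<in> cball 0 n" | "x \<notin> cball 0 n" "y \<notin> cball 0 n" by blast
    then show ?thesis
    proof cases
      case 1 then show ?thesis using full le[OF K(4)] by linarith
    next
      case 2 then show ?thesis using half[of x y] le[OF K(6)] by linarith
    next
      case 3 then show ?thesis using half[of y x] le[OF K(6)] by (simp add: dist_commute abs_minus_commute)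
    next
      case 4 then show ?thesis using K(1) by (simp add: zero)
    qed
  qed
  have lip_g: "\<bar>clamp_cutoff n g x - clamp_cutoff n g y\<bar> \<le> cutoff_upgrad n G x * dist x y + K * (dist x y)\<^sup>2" for x y
  proof -
    have split: "\<bar>clamp_cutoff n g x - clamp_cutoff n g y\<bar> \<le>
        cutoff n x * \<bar>c x - c y\<bar> + sqrt n / n * dist x y"
    proof -
      have "\<bar>clamp_cutoff n g x - clamp_cutoff n g y\<bar> = \<bar>cutoff n x * (c x - c y) + (cutoff n x - cutoff n y) * c y\<bar>"
        by (simp add: cc algebra_simps)
      also have "\<dots> \<le> \<bar>cutoff n x\<bar> * \<bar>c x - c y\<bar> + \<bar>cutoff n x - cutoff n y\<bar> * \<bar>c y\<bar>"
        by (metis abs_mult abs_triangle_ineq)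
      also have "\<dots> \<le> cutoff n x * \<bar>c x - c y\<bar> + (dist x y / n) * sqrt n"
        using cutoff_bounds(1)[of n x] cutoff_lipschitz[of n x y] c_bound[of y]
        by (intro add_mono mult_mono) auto
      finally show ?thesis by (simp add: mult.commute)
    qed
    consider "x \<in> cball 0 n" "y \<in> cball 0 n" | "x \<notin> cball 0 n" | "x \<in> cball 0 n" "y \<notin> cball 0 n"
      by blast
    then show ?thesis
    proof cases
      case 1
      have "cutoff n x * \<bar>c x - c y\<bar> \<le> cutoff n x * (G x * dist x y + L * (dist x y)\<^sup>2)"
      proof (rule mult_left_mono)
        have "\<bar>c x - c y\<bar> \<le> \<bar>g x - g y\<bar>" by (auto simp: c_def max_def min_def)
        with L(2)[OF 1] show "\<bar>c x - c y\<bar> \<le> G x * dist x y + L * (dist x y)\<^sup>2" by linarith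
      qed (rule cutoff_bounds)
      also have "\<dots> = cutoff n x * G x * dist x y + cutoff n x * (L * (dist x y)\<^sup>2)"
        by (simp add: algebra_simps)
      also have "\<dots> \<le> cutoff n x * G x * dist x y + 1 * (K * (dist x y)\<^sup>2)"
        using cutoff_bounds[of n x] K L0 by (intro add_left_mono mult_mono) auto
      finally show ?thesis
        using split by (simp add: cutoff_upgrad_def algebra_simps)
    next
      case 2
      then show ?thesis
        using split K(1) zero[OF 2] by (simp add: cutoff_upgrad_def add.commute add_increasing)
    next
      \<comment> \<open>The bound \<open>split\<close> is of no use here, because
        \<open>c x - c y\<close> is not controlled when \<open>y\<close> lies outside. Instead,
        \<open>cutoff n y = 0\<close> lets the whole difference be charged to the cutoff.\<close>
      case 3
      have "\<bar>clamp_cutoff n g x - clamp_cutoff n g y\<bar> = \<bar>cutoff n x - cutoff n y\<bar> * \<bar>c x\<bar>"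
        using zero[OF 3(2)] by (simp add: cc abs_mult)
      also have "\<dots> \<le> (dist x y / n) * sqrt n"
        using cutoff_lipschitz[of n x y] c_bound[of x] by (intro mult_mono) auto
      finally have "\<bar>clamp_cutoff n g x - clamp_cutoff n g y\<bar> \<le> sqrt n / n * dist x y"
        by (simp add: mult.commute)
      moreover have "0 \<le> cutoff n x * G x * dist x y" "0 \<le> K * (dist x y)\<^sup>2"
        using cutoff_bounds(1)[of n x] nonneg[of x] K(1) by auto
      ultimately show ?thesis
        by (simp add: cutoff_upgrad_def distrib_right)
    qed
  qed
  have "upgrad K (clamp_cutoff n g) (cutoff_upgrad n G)"
    unfolding upgrad_def
  proof (intro conjI allI)
    fix x y
    show "\<bar>clamp_cutoff n g x\<bar> \<le> K"
      using abs_clamp_cutoff_le(2)[of n g x] K(2) by linarith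
    show "0 \<le> cutoff_upgrad n G x"
      using nonneg by (rule cutoff_upgrad_bounds)
    show "cutoff_upgrad n G x \<le> K"
      using cG[of x] K(3) by (simp add: cutoff_upgrad_def)
    show "\<bar>cutoff_upgrad n G x - cutoff_upgrad n G y\<bar> \<le> K * dist x y"
      using lip_G by (simp add: cutoff_upgrad_def)
    show "\<bar>clamp_cutoff n g x - clamp_cutoff n g y\<bar> \<le> cutoff_upgrad n G x * dist x y + K * (dist x y)\<^sup>2"
      by (rule lip_g)
  qed
  then show ?thesis ..
qed

text \<open>On a set of measure less than 1/4 outside of which \<open>g\<close> is bounded, Cauchy-Schwarz bounds the
  mean of \<open>u n\<close> by half its root mean square, which the variance bound can absorb.\<close>
lemma square_integrable_of_bounded_variance:
  fixes u :: "nat \<Rightarrow> 'a::euclidean_space \<Rightarrow> real"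
  assumes m: "m \<in> prob_measures"
    and g: "g \<in> borel_measurable borel" and u: "\<And>n. u n \<in> borel_measurable borel"
    and bounded: "\<And>n x. \<bar>u n x\<bar> \<le> K n"
    and le: "\<And>n x. \<bar>u n x\<bar> \<le> \<bar>g x\<bar>" and lim: "\<And>x. (\<lambda>n. u n x) \<longlonglongrightarrow> g x"
    and var: "\<And>n. (\<integral>x. (u n x)\<^sup>2 \<partial>m) - (\<integral>x. u n x \<partial>m)\<^sup>2 \<le> B"
  shows "integrable m (\<lambda>x. (g x)\<^sup>2)"
proof -
  interpret prob_space m using prob_measuresD[OF m] by simp
  have [measurable_cong]: "sets m = sets borel" using prob_measuresD[OF m] by simp
  note [measurable] = g u
  have int_u: "integrable m (u n)" for n
    by (rule integrable_bounded[OF m u bounded])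
  have int_u2: "integrable m (\<lambda>x. (u n x)\<^sup>2)" for n
    by (rule integrable_bounded[OF m, of _ "(K n)\<^sup>2"]) (auto intro: abs_square_le bounded)
  define A where "A k = {x. \<bar>g x\<bar> > real k}" for k :: nat
  have [measurable]: "A k \<in> sets borel" for k
    unfolding A_def by measurable
  have int_A: "integrable m (\<lambda>x. (indicator (A k) x)\<^sup>2 :: real)" for k
    by (rule integrable_bounded[OF m, of _ 1]) (auto simp: indicator_def)
  \<comment> \<open>Since \<open>g\<close> is finite everywhere, each point leaves
    \<open>A k\<close> eventually. The indicator is squared to match
    \<open>Cauchy_Schwarz_integral\<close>.\<close>
  have "(\<lambda>k. \<integral>x. (indicator (A k) x)\<^sup>2 \<partial>m) \<longlonglongrightarrow> (\<integral>x. 0 \<partial>m :: real)"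
  proof (rule integral_dominated_convergence[where w = "\<lambda>_. 1"])
    have "(\<lambda>k. (indicator (A k) x)\<^sup>2 :: real) \<longlonglongrightarrow> 0" for x
    proof (rule tendsto_eventually)
      have "\<forall>\<^sub>F k in sequentially. \<bar>g x\<bar> \<le> real k"
        by real_asymp
      then show "\<forall>\<^sub>F k in sequentially. (indicator (A k) x)\<^sup>2 = (0::real)"
        by eventually_elim (simp add: A_def)
    qed
    then show "AE x in m. (\<lambda>k. (indicator (A k) x)\<^sup>2 :: real) \<longlonglongrightarrow> 0"
      by simp
  qed (auto simp: indicator_def)
  then have "\<forall>\<^sub>F k in sequentially. (\<integral>x. (indicator (A k) x)\<^sup>2 \<partial>m) < (1/4 :: real)"
    by (intro order_tendstoD) auto
  then obtain k where k: "(\<integral>x. (indicator (A k) x)\<^sup>2 \<partial>m) < (1/4 :: real)"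
    by (auto simp: eventually_sequentially)
  \<comment> \<open>The second moment is at most B + 2 k^2 + 2 J^2, and 2 J^2 is at most half of it.
    Solving for the second moment gives the stated constant, which does not depend on
    \<open>n\<close>.\<close>
  have u2_le: "(\<integral>x. (u n x)\<^sup>2 \<partial>m) \<le> 2 * B + 4 * (real k)\<^sup>2" for n
  proof -
    define J where "J = (\<integral>x. \<bar>indicator (A k) x * u n x\<bar> \<partial>m)"
    have int_J: "integrable m (\<lambda>x. indicator (A k) x * u n x)"
      by (rule Cauchy_Schwarz_integral[OF _ _ int_A int_u2]) auto
    have "J\<^sup>2 \<le> (\<integral>x. (indicator (A k) x)\<^sup>2 \<partial>m) * (\<integral>x. (u n x)\<^sup>2 \<partial>m)"
      unfolding J_def by (rule Cauchy_Schwarz_integral[OF _ _ int_A int_u2]) auto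
    also have "\<dots> \<le> (1/4) * (\<integral>x. (u n x)\<^sup>2 \<partial>m)"
      using k by (intro mult_right_mono) auto
    finally have J2: "J\<^sup>2 \<le> (1/4) * (\<integral>x. (u n x)\<^sup>2 \<partial>m)" .
    have pw: "\<bar>u n x\<bar> \<le> real k + \<bar>indicator (A k) x * u n x\<bar>" for x
      using le[of n x] by (auto simp: A_def indicator_def)
    have "\<bar>\<integral>x. u n x \<partial>m\<bar> \<le> (\<integral>x. \<bar>u n x\<bar> \<partial>m)"
      by (rule integral_abs_bound)
    also have "\<dots> \<le> (\<integral>x. real k + \<bar>indicator (A k) x * u n x\<bar> \<partial>m)"
      using int_u int_J pw by (intro integral_mono) auto
    also have "\<dots> = real k + J"
      using int_J by (simp add: J_def prob_space)
    finally have "(\<integral>x. u n x \<partial>m)\<^sup>2 \<le> (real k + J)\<^sup>2"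
      by (rule abs_square_le)
    also have "\<dots> \<le> 2 * (real k)\<^sup>2 + 2 * J\<^sup>2"
      using sum_squares_bound[of "real k" J] by (simp add: power2_sum)
    finally show ?thesis
      using var[of n] J2 by linarith
  qed
  \<comment> \<open>Fatou's lemma is used because the natural dominating function is the square of
    \<open>g\<close>, whose integrability is the claim.\<close>
  have "(\<integral>\<^sup>+x. ennreal ((g x)\<^sup>2) \<partial>m) = (\<integral>\<^sup>+x. liminf (\<lambda>n. ennreal ((u n x)\<^sup>2)) \<partial>m)"
    by (intro nn_integral_cong lim_imp_Liminf[symmetric] tendsto_ennrealI tendsto_power lim) simp
  also have "\<dots> \<le> liminf (\<lambda>n. \<integral>\<^sup>+x. ennreal ((u n x)\<^sup>2) \<partial>m)"
    by (rule nn_integral_liminf) simp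
  also have "\<dots> \<le> ennreal (2 * B + 4 * (real k)\<^sup>2)"
  proof (rule Liminf_le)
    show "\<forall>\<^sub>F n in sequentially. (\<integral>\<^sup>+x. ennreal ((u n x)\<^sup>2) \<partial>m) \<le> ennreal (2 * B + 4 * (real k)\<^sup>2)"
      using u2_le by (auto simp: nn_integral_eq_integral[OF int_u2] intro!: ennreal_leI always_eventually)
  qed simp
  also have "\<dots> < \<infinity>" by simp
  finally show ?thesis
    by (intro integrableI_nonneg) auto
qed

text \<open>This is the form in which the kernel estimates deliver the inequality: on a probability
  measure over \<open>borel\<close>, all functions involved are bounded, so real integrals suffice.
  It both follows from \<open>poincare\<close> and implies it, for a nonnegative constant.\<close>

definition compact_poincare :: "'a::euclidean_space measure \<Rightarrow> real \<Rightarrow> bool" where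
  "compact_poincare m C \<longleftrightarrow>
     (\<forall>K r g G. upgrad K g G \<and> (\<forall>x. norm x > r \<longrightarrow> g x = 0) \<longrightarrow>
       (\<integral>x. (g x)\<^sup>2 \<partial>m) - (\<integral>x. g x \<partial>m)\<^sup>2 \<le> C * (\<integral>x. (G x)\<^sup>2 \<partial>m))"

lemma poincare_imp_compact_poincare:
  "m \<in> prob_measures \<Longrightarrow> poincare m C \<Longrightarrow> 0 \<le> C \<Longrightarrow> compact_poincare m C"
  unfolding compact_poincare_def using poincare_compact_support[of m C] by blast

text \<open>If the right-hand side is finite, the energies of the truncations converge and hence
  bound their variances uniformly. This forces the square of \<open>g\<close> to be integrable,
  after which dominated convergence applies to the variances as well.\<close>

lemma poincare_local_upgrad:
  fixes g G :: "'a::euclidean_space \<Rightarrow> real"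
  assumes m: "m \<in> prob_measures" and C: "0 \<le> C"
    and H: "compact_poincare m C"
    and gG: "local_upgrad g G"
  shows "enn2ereal (\<integral>\<^sup>+ x. ennreal ((g x)\<^sup>2) \<partial>m) - ereal ((\<integral> x. g x \<partial>m)\<^sup>2)
          \<le> ereal C * enn2ereal (\<integral>\<^sup>+ x. ennreal ((G x)\<^sup>2) \<partial>m)" (is "?L \<le> ?R")
proof (cases "?R = \<infinity>")
  case False
  interpret prob_space m using prob_measuresD[OF m] by simp
  have [measurable_cong]: "sets m = sets borel" using prob_measuresD[OF m] by simp
  note [measurable] = local_upgrad_measurable[OF gG]
  have G0: "0 \<le> G x" for x using gG by (simp add: local_upgrad_def)
  define u where "u n = clamp_cutoff (Suc n) g" for n
  define U where "U n = cutoff_upgrad (Suc n) G" for n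
  have "\<exists>K. upgrad K (u n) (U n)" for n
    unfolding u_def U_def by (rule upgrad_clamp_cutoff[OF gG]) simp
  then obtain K where uU: "upgrad (K n) (u n) (U n)" for n by metis
  note [measurable] = upgrad_measurable[OF uU]
  have u_lim: "(\<lambda>n. u n x) \<longlonglongrightarrow> g x" for x
    unfolding u_def by (rule LIMSEQ_Suc) (rule clamp_cutoff_tendsto)
  have U_lim: "(\<lambda>n. U n x) \<longlonglongrightarrow> G x" for x
    unfolding U_def by (rule LIMSEQ_Suc) (rule cutoff_upgrad_tendsto)
  have u_le: "\<bar>u n x\<bar> \<le> \<bar>g x\<bar>" for n x
    unfolding u_def by (rule abs_clamp_cutoff_le)
  have "u n x = 0" if "norm x > real (Suc n)" for n x
    using that cutoff_eq_0[of "Suc n" x] by (simp add: u_def clamp_cutoff_def)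
  then have var: "(\<integral>x. (u n x)\<^sup>2 \<partial>m) - (\<integral>x. u n x \<partial>m)\<^sup>2 \<le> C * (\<integral>x. (U n x)\<^sup>2 \<partial>m)" for n
    using H uU unfolding compact_poincare_def by blast
  obtain b where b: "(\<lambda>n. C * (\<integral>x. (U n x)\<^sup>2 \<partial>m)) \<longlonglongrightarrow> b" "?R = ereal b"
    \<comment> \<open>\<open>0 * \<infinity> = 0\<close> in the extended reals, so for \<open>C = 0\<close> no integrability of \<open>G\<^sup>2\<close> is available.\<close>
  proof (cases "C = 0")
    case True
    then show thesis by (intro that[of 0]) (simp_all flip: zero_ereal_def)
  next
    case C_pos: False
    then have "(\<integral>\<^sup>+ x. ennreal ((G x)\<^sup>2) \<partial>m) \<noteq> \<infinity>"
      using False C by auto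
    then have int_G: "integrable m (\<lambda>x. (G x)\<^sup>2)"
      by (intro integrableI_nonneg) (auto simp: less_top)
    have "(\<lambda>n. \<integral>x. (U n x)\<^sup>2 \<partial>m) \<longlonglongrightarrow> (\<integral>x. (G x)\<^sup>2 \<partial>m)"
    proof (rule integral_dominated_convergence[where w = "\<lambda>x. 2 * (G x)\<^sup>2 + 2"])
      show "integrable m (\<lambda>x. 2 * (G x)\<^sup>2 + 2)" using int_G by auto
      show "AE x in m. (\<lambda>n. (U n x)\<^sup>2) \<longlonglongrightarrow> (G x)\<^sup>2"
        by (auto intro!: tendsto_power U_lim)
      have "(U n x)\<^sup>2 \<le> 2 * (G x)\<^sup>2 + 2" for n x
      proof -
        have "(U n x)\<^sup>2 \<le> (G x + 1)\<^sup>2"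
          unfolding U_def by (intro power_mono cutoff_upgrad_bounds G0)
        then show ?thesis
          using sum_squares_bound[of "G x" 1] by (simp add: power2_sum)
      qed
      then show "AE x in m. norm ((U n x)\<^sup>2) \<le> 2 * (G x)\<^sup>2 + 2" for n by simp
    qed auto
    then show thesis
      using nn_integral_eq_integral[OF int_G]
      by (intro that[of "C * (\<integral>x. (G x)\<^sup>2 \<partial>m)"] tendsto_mult_left) (auto simp: enn2ereal_ennreal)
  qed
  obtain B where B: "C * (\<integral>x. (U n x)\<^sup>2 \<partial>m) \<le> B" for n
    using convergent_imp_Bseq[OF convergentI[OF b(1)]] unfolding Bseq_def
    by (metis abs_le_D1 real_norm_def)
  have int_g2: "integrable m (\<lambda>x. (g x)\<^sup>2)"
  proof (rule square_integrable_of_bounded_variance[OF m, of g u K B])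
    show "(\<integral>x. (u n x)\<^sup>2 \<partial>m) - (\<integral>x. u n x \<partial>m)\<^sup>2 \<le> B" for n
      using var[of n] B[of n] by linarith
  qed (use upgradD(1)[OF uU] u_le u_lim in auto)
  \<comment> \<open>Integrability matters here because otherwise the integral of \<open>g\<close>
    would be the default value 0 and not the limit of the means of \<open>u n\<close>.\<close>
  have int_g: "integrable m g"
  proof (rule Bochner_Integration.integrable_bound)
    show "integrable m (\<lambda>x. (g x)\<^sup>2 + 1)" using int_g2 by auto
    have "\<bar>g x\<bar> \<le> (g x)\<^sup>2 + 1" for x
      using sum_squares_bound[of "\<bar>g x\<bar>" 1] by simp
    then show "AE x in m. norm (g x) \<le> norm ((g x)\<^sup>2 + 1)" by auto
  qed auto
  have lim2: "(\<lambda>n. \<integral>x. (u n x)\<^sup>2 \<partial>m) \<longlonglongrightarrow> (\<integral>x. (g x)\<^sup>2 \<partial>m)"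
    by (rule integral_dominated_convergence[where w = "\<lambda>x. (g x)\<^sup>2"])
      (auto intro!: tendsto_power u_lim int_g2 simp: abs_le_square_iff[symmetric] u_le)
  have lim1: "(\<lambda>n. \<integral>x. u n x \<partial>m) \<longlonglongrightarrow> (\<integral>x. g x \<partial>m)"
    by (rule integral_dominated_convergence[where w = "\<lambda>x. \<bar>g x\<bar>"])
      (auto intro!: u_lim int_g u_le)
  have "(\<integral>x. (g x)\<^sup>2 \<partial>m) - (\<integral>x. g x \<partial>m)\<^sup>2 \<le> b"
    by (rule LIMSEQ_le[OF tendsto_diff[OF lim2 tendsto_power[OF lim1]] b(1)]) (use var in auto)
  then show ?thesis
    unfolding b(2) using nn_integral_eq_integral[OF int_g2] by (simp add: enn2ereal_ennreal)
qed simp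

section \<open>Smooth functions and the return to the original Poincare inequality\<close>

lemma C1_lipschitz_on_cball:
  fixes p :: "'a::euclidean_space \<Rightarrow> real"
  assumes p: "C_diff (Suc 0) p"
  shows "\<exists>L\<ge>0. \<forall>x\<in>cball 0 r. \<forall>y\<in>cball 0 r. \<bar>p x - p y\<bar> \<le> L * dist x y"
proof -
  have diff: "p differentiable (at x)" for x using p by simp
  have "continuous_on (cball 0 r) (\<lambda>x. norm (grad p x))"
    unfolding grad_def using p
    by (intro continuous_intros) (auto intro: continuous_on_subset)
  then have "compact ((\<lambda>x. norm (grad p x)) ` cball 0 r)"
    by (intro compact_continuous_image) auto
  then have "bounded ((\<lambda>x. norm (grad p x)) ` cball 0 r)"
    by (rule compact_imp_bounded)
  then obtain L where L: "norm (grad p x) \<le> L" if "x \<in> cball 0 r" for x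
    unfolding bounded_iff by (metis image_eqI norm_ge_zero real_norm_def abs_of_nonneg)
  have "\<bar>p x - p y\<bar> \<le> max 0 L * dist x y" if "x \<in> cball 0 r" "y \<in> cball 0 r" for x y
    unfolding dist_norm real_norm_def[symmetric]
  proof (rule differentiable_bound[OF convex_cball _ _ that])
    fix z :: 'a assume z: "z \<in> cball 0 r"
    show "(p has_derivative (\<lambda>h. h \<bullet> grad p z)) (at z within cball 0 r)"
      using GDERIV_grad[OF diff] by (auto simp: gderiv_def intro: has_derivative_at_withinI)
    show "onorm (\<lambda>h. h \<bullet> grad p z) \<le> max 0 L"
    proof (rule onorm_le)
      fix h
      have "norm (h \<bullet> grad p z) \<le> norm h * norm (grad p z)"
        using Cauchy_Schwarz_ineq2 by simp
      also have "\<dots> \<le> norm h * max 0 L"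
        using L[OF z] by (intro mult_left_mono) auto
      finally show "norm (h \<bullet> grad p z) \<le> max 0 L * norm h" by (simp add: mult.commute)
    qed
  qed
  then show ?thesis by (intro exI[of _ "max 0 L"]) auto
qed

text \<open>This is Taylor's formula of second order: after the linear part at \<open>x\<close> is
  subtracted, the derivative at \<open>z\<close> is \<open>grad f z - grad f x\<close>, which the
  local Lipschitz bound on the gradient controls.\<close>

lemma local_upgrad_grad:
  fixes f :: "'a::euclidean_space \<Rightarrow> real"
  assumes f: "C_inf f"
  shows "local_upgrad f (\<lambda>x. norm (grad f x))"
  unfolding local_upgrad_def
proof (intro conjI allI)
  fix r :: real
  have f2: "C_diff (Suc (Suc 0)) f"
    using f unfolding C_inf_def by blast
  then have diff: "f differentiable (at x)" for x by simp
  have "\<exists>L\<ge>0. \<forall>x\<in>cball 0 r. \<forall>y\<in>cball 0 r.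
      \<bar>frechet_derivative f (at x) b - frechet_derivative f (at y) b\<bar> \<le> L * dist x y" if "b \<in> Basis" for b
    using f2 that by (intro C1_lipschitz_on_cball) simp
  then obtain L where L: "L b \<ge> 0" "\<bar>frechet_derivative f (at x) b - frechet_derivative f (at y) b\<bar> \<le> L b * dist x y"
    if "b \<in> Basis" "x \<in> cball 0 r" "y \<in> cball 0 r" for b x y
    by metis
  define K where "K = (\<Sum>b\<in>Basis. L b)"
  have lip: "norm (grad f x - grad f y) \<le> K * dist x y" if "x \<in> cball 0 r" "y \<in> cball 0 r" for x y
  proof -
    have "norm (grad f x - grad f y) \<le>
        (\<Sum>b\<in>Basis. norm ((frechet_derivative f (at x) b - frechet_derivative f (at y) b) *\<^sub>R b))"
      unfolding grad_def sum_subtractf[symmetric] scaleR_diff_left[symmetric] by (rule norm_sum)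
    also have "\<dots> \<le> (\<Sum>b\<in>Basis. L b * dist x y)"
      using L(2)[OF _ that] by (intro sum_mono) simp
    finally show ?thesis by (simp add: K_def sum_distrib_right)
  qed
  have K0: "0 \<le> K" if "x \<in> cball 0 r" for x :: 'a
    unfolding K_def by (intro sum_nonneg L(1)[OF _ that that])
  show "\<exists>K. \<forall>x\<in>cball 0 r. \<forall>y\<in>cball 0 r.
          \<bar>norm (grad f x) - norm (grad f y)\<bar> \<le> K * dist x y \<and>
          \<bar>f x - f y\<bar> \<le> norm (grad f x) * dist x y + K * (dist x y)\<^sup>2"
  proof (intro exI[of _ K] ballI conjI)
    fix x y :: 'a assume x: "x \<in> cball 0 r" and y: "y \<in> cball 0 r"
    show "\<bar>norm (grad f x) - norm (grad f y)\<bar> \<le> K * dist x y"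
      by (rule order_trans[OF norm_triangle_ineq3 lip[OF x y]])
    \<comment> \<open>Intersecting with the ball about \<open>x\<close> through \<open>y\<close>
      keeps the set convex and makes every \<open>z\<close> in it at most \<open>dist x y\<close>
      away from \<open>x\<close>. That distance is the second factor of the quadratic
      remainder.\<close>
    let ?S = "cball 0 r \<inter> cball x (dist x y)"
    have "norm ((f x - x \<bullet> grad f x) - (f y - y \<bullet> grad f x)) \<le> (K * dist x y) * norm (x - y)"
    proof (rule differentiable_bound[where S = ?S and f = "\<lambda>z. f z - z \<bullet> grad f x"
          and f' = "\<lambda>z h. h \<bullet> (grad f z - grad f x)"])
      fix z assume z: "z \<in> ?S"
      show "((\<lambda>z. f z - z \<bullet> grad f x) has_derivative (\<lambda>h. h \<bullet> (grad f z - grad f x))) (at z within ?S)"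
        unfolding inner_diff_right
      proof (rule has_derivative_diff)
        show "(f has_derivative (\<lambda>h. h \<bullet> grad f z)) (at z within ?S)"
          using GDERIV_grad[OF diff, of z] unfolding gderiv_def by (rule has_derivative_at_withinI)
        show "((\<lambda>z. z \<bullet> grad f x) has_derivative (\<lambda>h. h \<bullet> grad f x)) (at z within ?S)"
          by (rule bounded_linear_imp_has_derivative[OF bounded_linear_inner_left])
      qed
      show "onorm (\<lambda>h. h \<bullet> (grad f z - grad f x)) \<le> K * dist x y"
      proof (rule onorm_le)
        fix h
        have "norm (h \<bullet> (grad f z - grad f x)) \<le> norm h * norm (grad f z - grad f x)"
          using Cauchy_Schwarz_ineq2 by simp
        also have "\<dots> \<le> norm h * (K * dist x y)"
        proof (rule mult_left_mono)
          have "norm (grad f z - grad f x) \<le> K * dist z x" using z x by (intro lip) auto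
          also have "\<dots> \<le> K * dist x y" using z K0[OF x] by (intro mult_left_mono) (auto simp: dist_commute)
          finally show "norm (grad f z - grad f x) \<le> K * dist x y" .
        qed simp
        finally show "norm (h \<bullet> (grad f z - grad f x)) \<le> K * dist x y * norm h" by (simp add: mult.commute)
      qed
    qed (use x y in \<open>auto intro: convex_Int\<close>)
    then have "\<bar>(f x - f y) - (x - y) \<bullet> grad f x\<bar> \<le> K * (dist x y)\<^sup>2"
      by (simp add: dist_norm power2_eq_square inner_diff_left algebra_simps)
    moreover have "\<bar>(x - y) \<bullet> grad f x\<bar> \<le> norm (grad f x) * dist x y"
      using Cauchy_Schwarz_ineq2[of "x - y" "grad f x"] by (simp add: dist_norm mult.commute)
    ultimately show "\<bar>f x - f y\<bar> \<le> norm (grad f x) * dist x y + K * (dist x y)\<^sup>2"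
      by linarith
  qed
qed simp

lemma compact_poincare_imp_poincare:
  assumes "m \<in> prob_measures" "0 \<le> C" "compact_poincare m C"
  shows "poincare m C"
  unfolding poincare_def using poincare_local_upgrad[OF assms local_upgrad_grad] by simp

text \<open>This version without compact support is the one to apply to the pairs from
  \<open>upgrad_kernel\<close>, since an image under a kernel need not vanish at infinity.\<close>

lemma poincare_upgrad:
  fixes g G :: "'a::euclidean_space \<Rightarrow> real"
  assumes m: "m \<in> prob_measures" and "0 \<le> C" "poincare m C" and gG: "upgrad K g G"
  shows "(\<integral>x. (g x)\<^sup>2 \<partial>m) - (\<integral>x. g x \<partial>m)\<^sup>2 \<le> C * (\<integral>x. (G x)\<^sup>2 \<partial>m)"
proof -
  note [measurable] = upgrad_measurable[OF gG]
  have "enn2ereal (\<integral>\<^sup>+ x. ennreal ((g x)\<^sup>2) \<partial>m) - ereal ((\<integral> x. g x \<partial>m)\<^sup>2)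
          \<le> ereal C * enn2ereal (\<integral>\<^sup>+ x. ennreal ((G x)\<^sup>2) \<partial>m)"
    by (intro poincare_local_upgrad poincare_imp_compact_poincare upgrad_imp_local_upgrad[OF gG] assms)
  moreover have "integrable m (\<lambda>x. (g x)\<^sup>2)" "integrable m (\<lambda>x. (G x)\<^sup>2)"
    by (rule integrable_bounded[OF m, of _ "K\<^sup>2"]; auto intro: abs_square_le upgradD[OF gG])+
  ultimately show ?thesis
    by (simp add: nn_integral_eq_integral enn2ereal_ennreal)
qed

text \<open>A coordinate function has a gradient of norm 1, so the right-hand side is
  \<open>C\<close> itself, and it bounds a variance.\<close>

lemma poincare_constant_nonneg:
  fixes m :: "'a::euclidean_space measure"
  assumes m: "m \<in> prob_measures" and P: "poincare m C"
  shows "0 \<le> C"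
proof (rule ccontr)
  assume C: "\<not> 0 \<le> C"
  interpret prob_space m using prob_measuresD[OF m] by simp
  have [measurable_cong]: "sets m = sets borel" using prob_measuresD[OF m] by simp
  obtain b :: 'a where b: "b \<in> Basis" using nonempty_Basis by blast
  let ?f = "\<lambda>x. x \<bullet> b"
  have D: "(?f has_derivative (\<lambda>h. h \<bullet> b)) (at x)" for x
    by (auto intro!: derivative_eq_intros)
  have "grad ?f x = (\<Sum>i\<in>Basis. (i \<bullet> b) *\<^sub>R i)" for x
    unfolding grad_def frechet_derivative_at[OF D, symmetric] ..
  then have "grad ?f x = b" for x
    using euclidean_representation[of b] by (simp add: inner_commute)
  then have "(\<integral>\<^sup>+ x. ennreal ((norm (grad ?f x))\<^sup>2) \<partial>m) = 1"
    using b by (simp add: emeasure_space_1)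
  moreover have "poly_growth ?f"
    unfolding poly_growth_def using Basis_le_norm[OF b]
    by (intro exI[of _ 1]) (auto intro!: exI[of _ 1] order_trans[of _ "norm x" for x] simp: add_increasing)
  ultimately have *: "enn2ereal (\<integral>\<^sup>+ x. ennreal ((?f x)\<^sup>2) \<partial>m) - ereal ((\<integral> x. ?f x \<partial>m)\<^sup>2) \<le> ereal C"
    using P C_inf_inner[of b] by (auto simp: poincare_def one_ennreal.rep_eq)
  \<comment> \<open>An infinite second moment would make the left-hand side of \<open>*\<close>
    infinite, whatever the integral of the coordinate evaluates to.\<close>
  then have "(\<integral>\<^sup>+ x. ennreal ((?f x)\<^sup>2) \<partial>m) \<noteq> \<infinity>"
    by auto
  then have int: "integrable m (\<lambda>x. (?f x)\<^sup>2)"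
    by (intro integrableI_nonneg) (auto simp: less_top)
  have "(\<integral> x. ?f x \<partial>m)\<^sup>2 \<le> (\<integral>x. \<bar>1 * ?f x\<bar> \<partial>m)\<^sup>2"
    using integral_abs_bound[of m ?f] by (simp add: abs_le_square_iff[symmetric])
  also have "\<dots> \<le> (\<integral>x. 1\<^sup>2 \<partial>m) * (\<integral>x. (?f x)\<^sup>2 \<partial>m)"
    by (rule Cauchy_Schwarz_integral[OF _ _ _ int]) auto
  finally have "(\<integral> x. ?f x \<partial>m)\<^sup>2 \<le> (\<integral>x. (?f x)\<^sup>2 \<partial>m)"
    by (simp add: prob_space)
  moreover have "(\<integral>x. (?f x)\<^sup>2 \<partial>m) - (\<integral> x. ?f x \<partial>m)\<^sup>2 \<le> C"
    using * by (simp add: nn_integral_eq_integral[OF int] enn2ereal_ennreal)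
  ultimately show False using C by simp
qed

section \<open>Wasserstein contraction and gradient bounds\<close>

text \<open>Existence of an optimal coupling is avoided by the slack between \<open>a\<close> and
  \<open>t\<close>, which \<open>W2_upgrad\<close> removes by letting \<open>t\<close> decrease to
  \<open>a\<close>.\<close>

lemma W2_le_imp_coupling:
  assumes W: "W2 \<mu> \<nu> \<le> ennreal a" and a: "0 \<le> a" "a < t"
  shows "\<exists>\<pi>\<in>couplings \<mu> \<nu>. (\<integral>\<^sup>+ z. ennreal ((norm (fst z - snd z))\<^sup>2) \<partial>\<pi>) \<le> ennreal (t\<^sup>2)"
proof -
  define I where "I = (INF \<pi>\<in>couplings \<mu> \<nu>. \<integral>\<^sup>+ z. ennreal ((norm (fst z - snd z))\<^sup>2) \<partial>\<pi>)"
  have I: "I \<noteq> \<infinity>" "ennreal (sqrt (enn2real I)) \<le> ennreal a"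
    using W by (auto simp: W2_def Let_def I_def[symmetric] top_unique split: if_splits)
  then have "sqrt (enn2real I) \<le> a"
    using a by (simp add: ennreal_le_iff)
  then have "enn2real I < t\<^sup>2"
    using a by (smt (verit) real_sqrt_le_iff real_sqrt_abs real_sqrt_less_iff)
  then have "ennreal (enn2real I) < ennreal (t\<^sup>2)"
    using a by (intro ennreal_lessI) auto
  with I have "I < ennreal (t\<^sup>2)"
    by (simp add: ennreal_enn2real less_top)
  then show ?thesis
    unfolding I_def INF_less_iff by (auto intro: less_imp_le)
qed

lemma couplingD:
  fixes \<mu> \<nu> :: "'a::euclidean_space measure" and h :: "'a \<Rightarrow> real"
  assumes \<pi>: "\<pi> \<in> couplings \<mu> \<nu>"
  shows "prob_space \<pi>" "sets \<pi> = sets (borel \<Otimes>\<^sub>M borel)"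
    and "h \<in> borel_measurable borel \<Longrightarrow> (\<integral>x. h x \<partial>\<mu>) = (\<integral>z. h (fst z) \<partial>\<pi>)"
    and "h \<in> borel_measurable borel \<Longrightarrow> (\<integral>x. h x \<partial>\<nu>) = (\<integral>z. h (snd z) \<partial>\<pi>)"
proof -
  show "prob_space \<pi>" and s [measurable_cong]: "sets \<pi> = sets (borel \<Otimes>\<^sub>M borel)"
    using \<pi> by (auto simp: couplings_def space_prob_algebra)
  have "\<mu> = distr \<pi> borel fst" "\<nu> = distr \<pi> borel snd"
    using \<pi> by (auto simp: couplings_def)
  then show "h \<in> borel_measurable borel \<Longrightarrow> (\<integral>x. h x \<partial>\<mu>) = (\<integral>z. h (fst z) \<partial>\<pi>)"
    and "h \<in> borel_measurable borel \<Longrightarrow> (\<integral>x. h x \<partial>\<nu>) = (\<integral>z. h (snd z) \<partial>\<pi>)"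
    by (simp_all add: integral_distr)
qed

text \<open>The first estimate integrates the bound of \<open>upgrad\<close> against the coupling
  and applies Cauchy-Schwarz to the linear term. The second is what makes the upper gradient in
  \<open>upgrad_kernel\<close> Lipschitz in the starting point.\<close>

lemma coupling_upgrad:
  fixes \<mu> \<nu> :: "'a::euclidean_space measure"
  assumes \<pi>: "\<pi> \<in> couplings \<mu> \<nu>" and t: "0 \<le> t"
    and cost: "(\<integral>\<^sup>+ z. ennreal ((norm (fst z - snd z))\<^sup>2) \<partial>\<pi>) \<le> ennreal (t\<^sup>2)"
    and gG: "upgrad K g G"
  shows "\<bar>(\<integral>x. g x \<partial>\<mu>) - (\<integral>x. g x \<partial>\<nu>)\<bar> \<le> sqrt (\<integral>x. (G x)\<^sup>2 \<partial>\<mu>) * t + K * t\<^sup>2"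
    and "\<bar>sqrt (\<integral>x. (G x)\<^sup>2 \<partial>\<mu>) - sqrt (\<integral>x. (G x)\<^sup>2 \<partial>\<nu>)\<bar> \<le> K * t"
proof -
  interpret prob_space \<pi> by (rule couplingD[OF \<pi>])
  note [measurable_cong] = couplingD(2)[OF \<pi>]
  note [measurable] = upgrad_measurable[OF gG]
  note D = upgradD[OF gG]
  define d where "d z = dist (fst z) (snd z)" for z :: "'a \<times> 'a"
  have [measurable]: "d \<in> borel_measurable \<pi>"
    unfolding d_def by measurable
  have d0: "0 \<le> d z" for z by (simp add: d_def)
  have cost_d: "(\<integral>\<^sup>+ z. ennreal ((d z)\<^sup>2) \<partial>\<pi>) \<le> ennreal (t\<^sup>2)"
    using cost by (simp add: d_def dist_norm)
  have int_d2: "integrable \<pi> (\<lambda>z. (d z)\<^sup>2)"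
    using le_less_trans[OF cost_d] by (intro integrableI_nonneg) auto
  then have d2: "(\<integral>z. (d z)\<^sup>2 \<partial>\<pi>) \<le> t\<^sup>2"
    using cost_d by (simp add: nn_integral_eq_integral)
  have int_bd: "integrable \<pi> (\<lambda>z. h (p z))"
    if "h \<in> borel_measurable borel" "p \<in> \<pi> \<rightarrow>\<^sub>M borel" "\<And>x. \<bar>h x\<bar> \<le> B" for h :: "'a \<Rightarrow> real" and p B
    using that by (intro integrable_const_bound[where B = B]) auto
  have G2: "\<bar>(G x)\<^sup>2\<bar> \<le> K\<^sup>2" for x using abs_square_le[OF D(7)] by simp
  have int_G2: "integrable \<pi> (\<lambda>z. (G (p z))\<^sup>2)" if "p \<in> \<pi> \<rightarrow>\<^sub>M borel" for p
    using int_bd[of "\<lambda>x. (G x)\<^sup>2" p, OF _ that G2] by simp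
  have CS: "integrable \<pi> (\<lambda>z. G (p z) * d z)"
      "(\<integral>z. G (p z) * d z \<partial>\<pi>) \<le> sqrt (\<integral>z. (G (p z))\<^sup>2 \<partial>\<pi>) * t"
    if p [measurable]: "p \<in> \<pi> \<rightarrow>\<^sub>M borel" for p
  proof -
    show "integrable \<pi> (\<lambda>z. G (p z) * d z)"
      by (rule Cauchy_Schwarz_integral[OF _ _ int_G2[OF p] int_d2]) auto
    have "(\<integral>z. \<bar>G (p z) * d z\<bar> \<partial>\<pi>)\<^sup>2 \<le> (\<integral>z. (G (p z))\<^sup>2 \<partial>\<pi>) * (\<integral>z. (d z)\<^sup>2 \<partial>\<pi>)"
      by (rule Cauchy_Schwarz_integral[OF _ _ int_G2[OF p] int_d2]) auto
    also have "\<dots> \<le> (\<integral>z. (G (p z))\<^sup>2 \<partial>\<pi>) * t\<^sup>2"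
      using d2 by (intro mult_left_mono) auto
    also have "\<dots> = (sqrt (\<integral>z. (G (p z))\<^sup>2 \<partial>\<pi>) * t)\<^sup>2"
      by (simp add: power_mult_distrib)
    finally have "(\<integral>z. \<bar>G (p z) * d z\<bar> \<partial>\<pi>) \<le> sqrt (\<integral>z. (G (p z))\<^sup>2 \<partial>\<pi>) * t"
      by (rule power2_le_imp_le) (simp add: t)
    then show "(\<integral>z. G (p z) * d z \<partial>\<pi>) \<le> sqrt (\<integral>z. (G (p z))\<^sup>2 \<partial>\<pi>) * t"
      by (simp add: D(2) d0 abs_mult)
  qed
  have [measurable]: "fst \<in> \<pi> \<rightarrow>\<^sub>M borel" "snd \<in> \<pi> \<rightarrow>\<^sub>M borel"
    by (simp_all cong: measurable_cong_sets)
  have int_g: "integrable \<pi> (\<lambda>z. g (fst z))" "integrable \<pi> (\<lambda>z. g (snd z))"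
    by (rule int_bd[of g fst K] int_bd[of g snd K]; simp add: D)+
  have "\<bar>(\<integral>x. g x \<partial>\<mu>) - (\<integral>x. g x \<partial>\<nu>)\<bar> = \<bar>\<integral>z. g (fst z) - g (snd z) \<partial>\<pi>\<bar>"
    using int_g by (simp add: couplingD[OF \<pi>])
  also have "\<dots> \<le> (\<integral>z. \<bar>g (fst z) - g (snd z)\<bar> \<partial>\<pi>)"
    by (rule integral_abs_bound)
  also have "\<dots> \<le> (\<integral>z. G (fst z) * d z + K * (d z)\<^sup>2 \<partial>\<pi>)"
    using int_g int_d2 CS(1)[of fst] D(5) by (intro integral_mono) (auto simp: d_def)
  also have "\<dots> = (\<integral>z. G (fst z) * d z \<partial>\<pi>) + K * (\<integral>z. (d z)\<^sup>2 \<partial>\<pi>)"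
    using int_d2 CS(1)[of fst] by simp
  also have "\<dots> \<le> sqrt (\<integral>z. (G (fst z))\<^sup>2 \<partial>\<pi>) * t + K * t\<^sup>2"
    using CS(2)[of fst] d2 D(6) by (intro add_mono mult_left_mono) auto
  finally show "\<bar>(\<integral>x. g x \<partial>\<mu>) - (\<integral>x. g x \<partial>\<nu>)\<bar> \<le> sqrt (\<integral>x. (G x)\<^sup>2 \<partial>\<mu>) * t + K * t\<^sup>2"
    by (simp add: couplingD(3)[OF \<pi>, of "\<lambda>x. (G x)\<^sup>2"])
  \<comment> \<open>The difference of the two norms is recovered from that of their squares: the
    latter is at most K t (p + q), and p + q cancels unless both norms vanish.\<close>
  define p q where "p = sqrt (\<integral>z. (G (fst z))\<^sup>2 \<partial>\<pi>)" and "q = sqrt (\<integral>z. (G (snd z))\<^sup>2 \<partial>\<pi>)"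
  have pq: "0 \<le> p" "0 \<le> q" by (simp_all add: p_def q_def)
  have "\<bar>p - q\<bar> * (p + q) = \<bar>p\<^sup>2 - q\<^sup>2\<bar>"
    using pq by (simp add: square_diff_square_factored power2_eq_square abs_mult mult.commute)
  also have "\<dots> = \<bar>\<integral>z. (G (fst z))\<^sup>2 - (G (snd z))\<^sup>2 \<partial>\<pi>\<bar>"
    using int_G2[of fst] int_G2[of snd] by (simp add: p_def q_def)
  also have "\<dots> \<le> (\<integral>z. \<bar>(G (fst z))\<^sup>2 - (G (snd z))\<^sup>2\<bar> \<partial>\<pi>)"
    by (rule integral_abs_bound)
  also have "\<dots> \<le> (\<integral>z. K * (G (fst z) * d z + G (snd z) * d z) \<partial>\<pi>)"
  proof (rule integral_mono)
    fix z
    have "\<bar>(G (fst z))\<^sup>2 - (G (snd z))\<^sup>2\<bar> = \<bar>G (fst z) - G (snd z)\<bar> * (G (fst z) + G (snd z))"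
      using D(2)[of "fst z"] D(2)[of "snd z"]
      by (simp add: square_diff_square_factored power2_eq_square abs_mult mult.commute)
    also have "\<dots> \<le> (K * d z) * (G (fst z) + G (snd z))"
      using D(2)[of "fst z"] D(2)[of "snd z"] D(4) by (intro mult_right_mono) (auto simp: d_def)
    finally show "\<bar>(G (fst z))\<^sup>2 - (G (snd z))\<^sup>2\<bar> \<le> K * (G (fst z) * d z + G (snd z) * d z)"
      by (simp add: algebra_simps)
  qed (use int_G2[of fst] int_G2[of snd] CS(1)[of fst] CS(1)[of snd] in auto)
  also have "\<dots> = K * ((\<integral>z. G (fst z) * d z \<partial>\<pi>) + (\<integral>z. G (snd z) * d z \<partial>\<pi>))"
    using CS(1)[of fst] CS(1)[of snd] by simp
  also have "\<dots> \<le> K * (p * t + q * t)"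
    using CS(2)[of fst] CS(2)[of snd] D(6) unfolding p_def q_def by (intro add_mono mult_left_mono) auto
  also have "\<dots> = (K * t) * (p + q)"
    by (simp add: algebra_simps)
  finally have *: "\<bar>p - q\<bar> * (p + q) \<le> (K * t) * (p + q)" .
  have "\<bar>p - q\<bar> \<le> K * t"
  proof (cases "p + q = 0")
    case True
    then have "p = 0" "q = 0" using pq by auto
    then show ?thesis using D(6) t by simp
  next
    case False
    then have "p + q > 0" using pq by simp
    with * show ?thesis by (rule mult_right_le_imp_le)
  qed
  then show "\<bar>sqrt (\<integral>x. (G x)\<^sup>2 \<partial>\<mu>) - sqrt (\<integral>x. (G x)\<^sup>2 \<partial>\<nu>)\<bar> \<le> K * t"
    unfolding p_def q_def
    by (simp add: couplingD(3)[OF \<pi>, of "\<lambda>x. (G x)\<^sup>2"] couplingD(4)[OF \<pi>, of "\<lambda>x. (G x)\<^sup>2"])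
qed

lemma W2_upgrad:
  fixes \<mu> \<nu> :: "'a::euclidean_space measure"
  assumes W: "W2 \<mu> \<nu> \<le> ennreal a" and a: "0 \<le> a" and gG: "upgrad K g G"
  shows "\<bar>(\<integral>x. g x \<partial>\<mu>) - (\<integral>x. g x \<partial>\<nu>)\<bar> \<le> sqrt (\<integral>x. (G x)\<^sup>2 \<partial>\<mu>) * a + K * a\<^sup>2"
    and "\<bar>sqrt (\<integral>x. (G x)\<^sup>2 \<partial>\<mu>) - sqrt (\<integral>x. (G x)\<^sup>2 \<partial>\<nu>)\<bar> \<le> K * a"
proof -
  have le: "\<bar>(\<integral>x. g x \<partial>\<mu>) - (\<integral>x. g x \<partial>\<nu>)\<bar> \<le> sqrt (\<integral>x. (G x)\<^sup>2 \<partial>\<mu>) * t + K * t\<^sup>2"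
    "\<bar>sqrt (\<integral>x. (G x)\<^sup>2 \<partial>\<mu>) - sqrt (\<integral>x. (G x)\<^sup>2 \<partial>\<nu>)\<bar> \<le> K * t" if "a < t" for t
    using W2_le_imp_coupling[OF W a that] coupling_upgrad[OF _ _ _ gG, of _ _ _ t] a that by force+
  have lim: "((\<lambda>t. sqrt (\<integral>x. (G x)\<^sup>2 \<partial>\<mu>) * t + K * t\<^sup>2) \<longlongrightarrow> sqrt (\<integral>x. (G x)\<^sup>2 \<partial>\<mu>) * a + K * a\<^sup>2) (at_right a)"
    "((\<lambda>t. K * t) \<longlongrightarrow> K * a) (at_right a)"
    by (intro tendsto_intros)+
  show "\<bar>(\<integral>x. g x \<partial>\<mu>) - (\<integral>x. g x \<partial>\<nu>)\<bar> \<le> sqrt (\<integral>x. (G x)\<^sup>2 \<partial>\<mu>) * a + K * a\<^sup>2"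
    by (rule tendsto_lowerbound[OF lim(1) eventually_mono[OF eventually_at_right_less]]) (auto intro: le)
  show "\<bar>sqrt (\<integral>x. (G x)\<^sup>2 \<partial>\<mu>) - sqrt (\<integral>x. (G x)\<^sup>2 \<partial>\<nu>)\<bar> \<le> K * a"
    by (rule tendsto_lowerbound[OF lim(2) eventually_mono[OF eventually_at_right_less]]) (auto intro: le)
qed

text \<open>With \<open>P x\<close> and \<open>P y\<close> as the two measures, the estimates of
  \<open>W2_upgrad\<close> have the shape of \<open>upgrad\<close> again. The factor
  \<open>c\<close> enters once in the linear term and twice in the remainder.\<close>

lemma upgrad_kernel:
  fixes P :: "'a::euclidean_space \<Rightarrow> 'a measure"
  assumes P: "\<And>x. P x \<in> prob_measures" and c: "0 \<le> c"
    and W: "\<And>x y. W2 (P x) (P y) \<le> ennreal (c * dist x y)"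
    and gG: "upgrad K g G"
  shows "\<exists>K'. upgrad K' (\<lambda>x. \<integral>y. g y \<partial>P x) (\<lambda>x. c * sqrt (\<integral>y. (G y)\<^sup>2 \<partial>P x))"
proof -
  note D = upgradD[OF gG]
  note [measurable] = upgrad_measurable[OF gG]
  let ?G = "\<lambda>x. sqrt (\<integral>y. (G y)\<^sup>2 \<partial>P x)"
  \<comment> \<open>The three summands serve the bound on the function, the bound on its upper
    gradient, and the Lipschitz and remainder terms, in which \<open>c\<close> occurs
    squared.\<close>
  define K' where "K' = K + c * K + c\<^sup>2 * K"
  have K': "K \<le> K'" "c * K \<le> K'" "c\<^sup>2 * K \<le> K'"
    using c D(6) by (auto simp: K'_def)
  have cd: "0 \<le> c * dist x y" for x y :: 'a using c by simp
  have G_le: "?G x \<le> K" for x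
  proof -
    have "(\<integral>y. (G y)\<^sup>2 \<partial>P x) \<le> K\<^sup>2"
      by (rule order_trans[OF abs_ge_self abs_integral_le[OF P]]) (auto intro: abs_square_le D)
    then show ?thesis using D(6) by (intro real_le_lsqrt) auto
  qed
  have "upgrad K' (\<lambda>x. \<integral>y. g y \<partial>P x) (\<lambda>x. c * ?G x)"
    unfolding upgrad_def
  proof (intro conjI allI)
    fix x y :: 'a
    have "\<bar>\<integral>y. g y \<partial>P x\<bar> \<le> K"
      by (rule abs_integral_le[OF P]) (auto intro: D)
    then show "\<bar>\<integral>y. g y \<partial>P x\<bar> \<le> K'" using K'(1) by linarith
    show "0 \<le> c * ?G x" using c by simp
    have "c * ?G x \<le> c * K" using c G_le by (intro mult_left_mono)
    then show "c * ?G x \<le> K'" using K'(2) by linarith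
    have "\<bar>c * ?G x - c * ?G y\<bar> = c * \<bar>?G x - ?G y\<bar>"
      using c by (simp add: right_diff_distrib[symmetric] abs_mult)
    also have "\<dots> \<le> c * (K * (c * dist x y))"
      using c by (intro mult_left_mono W2_upgrad[OF W cd gG])
    also have "\<dots> = (c\<^sup>2 * K) * dist x y" by (simp add: power2_eq_square)
    also have "\<dots> \<le> K' * dist x y" using K'(3) by (intro mult_right_mono) auto
    finally show "\<bar>c * ?G x - c * ?G y\<bar> \<le> K' * dist x y" .
    have "\<bar>(\<integral>y. g y \<partial>P x) - (\<integral>z. g z \<partial>P y)\<bar> \<le> ?G x * (c * dist x y) + K * (c * dist x y)\<^sup>2"
      by (rule W2_upgrad[OF W cd gG])
    also have "\<dots> = c * ?G x * dist x y + (c\<^sup>2 * K) * (dist x y)\<^sup>2"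
      by (simp add: power_mult_distrib mult_ac)
    also have "\<dots> \<le> c * ?G x * dist x y + K' * (dist x y)\<^sup>2"
      using K'(3) by (intro add_left_mono mult_right_mono) auto
    finally show "\<bar>(\<integral>y. g y \<partial>P x) - (\<integral>z. g z \<partial>P y)\<bar> \<le> c * ?G x * dist x y + K' * (dist x y)\<^sup>2" .
  qed
  then show ?thesis ..
qed

text \<open>The Dirac measure at \<open>(x, y)\<close> is a coupling. Starting the chain at Dirac
  measures turns contraction between measures into the pointwise hypothesis of
  \<open>upgrad_kernel\<close>.\<close>

lemma W2_return_le: "W2 (return borel x) (return borel y) \<le> ennreal (dist x y)" for x y :: "'a::euclidean_space"
proof -
  let ?\<pi> = "return (borel \<Otimes>\<^sub>M borel) (x, y)"
  define I where "I = (INF \<pi>\<in>couplings (return borel x) (return borel y). \<integral>\<^sup>+ z. ennreal ((norm (fst z - snd z))\<^sup>2) \<partial>\<pi>)"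
  have "?\<pi> \<in> couplings (return borel x) (return borel y)"
    by (auto simp: couplings_def space_prob_algebra distr_return space_pair_measure intro!: prob_space_return)
  then have "I \<le> (\<integral>\<^sup>+ z. ennreal ((norm (fst z - snd z))\<^sup>2) \<partial>?\<pi>)"
    unfolding I_def by (rule INF_lower)
  also have "\<dots> = ennreal ((dist x y)\<^sup>2)"
    by (subst nn_integral_return) (auto simp: dist_norm space_pair_measure)
  finally have I: "I \<le> ennreal ((dist x y)\<^sup>2)" .
  then have "enn2real I \<le> (dist x y)\<^sup>2"
    using enn2real_mono[OF I] by simp
  then have "sqrt (enn2real I) \<le> dist x y"
    by (simp add: real_le_lsqrt)
  moreover have "I \<noteq> \<infinity>"
    using I by (auto simp: top_unique)
  ultimately show ?thesis
    by (simp add: W2_def Let_def I_def[symmetric] ennreal_leI)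
qed

section \<open>Iterates of the kernel\<close>

lemma kernel_in_prob_measures:
  assumes "markov_kernel P"
  shows "P x \<in> prob_measures"
  using assms by (rule measurable_space) simp

lemma bind_in_prob_measures:
  assumes "\<mu> \<in> prob_measures" "markov_kernel P"
  shows "\<mu> \<bind> P \<in> prob_measures"
  using prob_space_bind'[OF assms] sets_bind'[OF assms] by (simp add: space_prob_algebra)

lemma return_in_prob_measures: "return borel x \<in> prob_measures"
  by (simp add: space_prob_algebra prob_space_return)

lemma markov_kernel_pow: "markov_kernel Q \<Longrightarrow> markov_kernel (kernel_pow Q k)"
  by (induction k) (simp_all add: measurable_bind_prob_space)

lemma return_bind_kernel: "markov_kernel P \<Longrightarrow> return borel x \<bind> P = P x"
  by (rule bind_return) (auto intro: measurable_prob_algebraD)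

lemma bind_return_borel: "\<mu> \<in> prob_measures \<Longrightarrow> \<mu> \<bind> return borel = \<mu>"
  by (rule bind_return'') (rule prob_measuresD)

lemma bind_kernel_pow_Suc:
  assumes "\<mu> \<in> prob_measures" "markov_kernel Q"
  shows "\<mu> \<bind> kernel_pow Q (Suc k) = (\<mu> \<bind> kernel_pow Q k) \<bind> Q"
proof -
  have "kernel_pow Q k \<in> \<mu> \<rightarrow>\<^sub>M subprob_algebra borel"
    using measurable_prob_algebraD[OF markov_kernel_pow[OF assms(2)]] prob_measuresD(2)[OF assms(1)]
    by (simp cong: measurable_cong_sets)
  from bind_assoc[OF this measurable_prob_algebraD[OF assms(2)]] show ?thesis
    by simp
qed

text \<open>The recursion of \<open>kernel_pow\<close> appends the new step at the end, whereas the
  induction in \<open>variance_kernel_pow\<close> splits off the first one.\<close>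

lemma bind_kernel_pow_Suc':
  assumes "\<mu> \<in> prob_measures" "markov_kernel Q"
  shows "\<mu> \<bind> kernel_pow Q (Suc k) = (\<mu> \<bind> Q) \<bind> kernel_pow Q k"
proof (induction k)
  case 0
  show ?case
    unfolding bind_kernel_pow_Suc[OF assms]
    using assms by (simp add: bind_return_borel bind_in_prob_measures)
next
  case (Suc k)
  have "\<mu> \<bind> kernel_pow Q (Suc (Suc k)) = (\<mu> \<bind> Q) \<bind> kernel_pow Q k \<bind> Q"
    unfolding bind_kernel_pow_Suc[OF assms, of "Suc k"] Suc.IH ..
  also have "\<dots> = (\<mu> \<bind> Q) \<bind> kernel_pow Q (Suc k)"
    by (rule bind_kernel_pow_Suc[symmetric, OF bind_in_prob_measures[OF assms] assms(2)])
  finally show ?case .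
qed

lemma kernel_pow_Suc':
  assumes "markov_kernel Q"
  shows "kernel_pow Q (Suc k) x = Q x \<bind> kernel_pow Q k"
  using bind_kernel_pow_Suc'[OF return_in_prob_measures assms, of x k]
  by (simp only: return_bind_kernel assms markov_kernel_pow)

lemma integral_bind_kernel:
  fixes f :: "'a::euclidean_space \<Rightarrow> real"
  assumes \<mu>: "\<mu> \<in> prob_measures" and P: "markov_kernel P"
    and f: "f \<in> borel_measurable borel" "\<And>x. \<bar>f x\<bar> \<le> K"
  shows "(\<integral>x. f x \<partial>(\<mu> \<bind> P)) = (\<integral>x. \<integral>y. f y \<partial>P x \<partial>\<mu>)"
proof (rule integral_bind[where B = K and B' = 1 and K = borel])
  show "P \<in> \<mu> \<rightarrow>\<^sub>M subprob_algebra borel"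
    using measurable_prob_algebraD[OF P] prob_measuresD(2)[OF \<mu>]
    by (simp cong: measurable_cong_sets)
  show "finite_measure \<mu>"
    using prob_measuresD(1)[OF \<mu>] by (simp add: prob_space_def)
  have "emeasure (P x) (space (P x)) = 1" for x
    using prob_space.emeasure_space_1[OF prob_measuresD(1)[OF kernel_in_prob_measures[OF P]]] .
  then show "AE x in \<mu>. emeasure (P x) (space (P x)) \<le> ennreal 1"
    by simp
qed (use f in auto)

lemma measurable_kernel_integral:
  fixes f :: "'a::euclidean_space \<Rightarrow> real"
  assumes P: "markov_kernel P" and f: "f \<in> borel_measurable borel"
  shows "(\<lambda>x. \<integral>y. f y \<partial>P x) \<in> borel_measurable borel"
  using measurable_compose[OF measurable_prob_algebraD[OF P] integral_measurable_subprob_algebra[OF f]] .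

lemma abs_kernel_integral_le:
  fixes f :: "'a::euclidean_space \<Rightarrow> real"
  assumes "markov_kernel P" "f \<in> borel_measurable borel" "\<And>x. \<bar>f x\<bar> \<le> K"
  shows "\<bar>\<integral>y. f y \<partial>P x\<bar> \<le> K"
  by (rule abs_integral_le[OF kernel_in_prob_measures[OF assms(1)] assms(2,3)])

text \<open>The left-hand side telescopes over the steps of the chain: the induction splits off the first
  step, whose contribution is controlled by the local inequality for \<open>Q\<close> applied to \<open>Q\<^sup>k g\<close>.\<close>
lemma variance_kernel_pow:
  fixes Q :: "'a::euclidean_space \<Rightarrow> 'a measure"
  assumes Q: "markov_kernel Q" and LP: "local_poincare Q C" and gG: "upgrad K g G"
    and c: "\<And>k. 0 \<le> c k"
    and W: "\<And>k x y. W2 (kernel_pow Q k x) (kernel_pow Q k y) \<le> ennreal (c k * dist x y)"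
    and \<mu>: "\<mu> \<in> prob_measures"
  shows "(\<integral>x. (g x)\<^sup>2 \<partial>(\<mu> \<bind> kernel_pow Q k)) - (\<integral>x. (\<integral>y. g y \<partial>kernel_pow Q k x)\<^sup>2 \<partial>\<mu>)
    \<le> C * (\<Sum>j<k. (c j)\<^sup>2) * (\<integral>x. (G x)\<^sup>2 \<partial>(\<mu> \<bind> kernel_pow Q k))"
  using \<mu>
\<comment> \<open>The starting law is generalised because splitting off the first step restarts the
  chain from \<mu>Q.\<close>
proof (induction k arbitrary: \<mu>)
  case 0
  have "g \<in> borel_measurable borel" by (rule upgrad_measurable[OF gG])
  then have "(\<integral>y. g y \<partial>return borel x) = g x" for x
    by (intro integral_return) auto
  with 0 show ?case
    by (simp add: bind_return_borel)
next
  case (Suc k)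
  note D = upgradD[OF gG]
  note [measurable] = upgrad_measurable[OF gG]
  note Qk = markov_kernel_pow[OF Q, of k]
  have C: "0 \<le> C"
    using poincare_constant_nonneg[OF kernel_in_prob_measures[OF Q]] LP by (auto simp: local_poincare_def)
  define \<nu> where "\<nu> = \<mu> \<bind> Q"
  have \<nu>: "\<nu> \<in> prob_measures"
    unfolding \<nu>_def by (rule bind_in_prob_measures[OF Suc.prems Q])
  have eq: "\<mu> \<bind> kernel_pow Q (Suc k) = \<nu> \<bind> kernel_pow Q k"
    unfolding \<nu>_def by (rule bind_kernel_pow_Suc'[OF Suc.prems Q])
  define u where "u x = (\<integral>y. g y \<partial>kernel_pow Q k x)" for x
  define V where "V x = (\<integral>y. (G y)\<^sup>2 \<partial>kernel_pow Q k x)" for x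
  \<comment> \<open>By the Markov property this energy is shared by the split-off step and by the
    remaining \<open>k\<close> steps, so the coefficients simply add up.\<close>
  define E where "E = (\<integral>x. (G x)\<^sup>2 \<partial>(\<nu> \<bind> kernel_pow Q k))"
  have G2: "\<bar>(G x)\<^sup>2\<bar> \<le> K\<^sup>2" for x using abs_square_le[OF D(7)] by simp
  have u_meas [measurable]: "u \<in> borel_measurable borel"
    unfolding u_def by (rule measurable_kernel_integral[OF Qk]) simp
  have V_meas [measurable]: "V \<in> borel_measurable borel"
    unfolding V_def by (rule measurable_kernel_integral[OF Qk]) simp
  have u_le: "\<bar>u x\<bar> \<le> K" for x
    unfolding u_def by (rule abs_kernel_integral_le[OF Qk]) (auto intro: D)
  have u2_le: "\<bar>(u x)\<^sup>2\<bar> \<le> K\<^sup>2" for x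
    using abs_square_le[OF u_le] by simp
  have V_le: "\<bar>V x\<bar> \<le> K\<^sup>2" for x
    unfolding V_def by (rule abs_kernel_integral_le[OF Qk]) (auto intro: abs_square_le D)
  have V0: "0 \<le> V x" for x unfolding V_def by simp
  have E: "E = (\<integral>x. \<integral>y. V y \<partial>Q x \<partial>\<mu>)"
  proof -
    have "E = (\<integral>x. V x \<partial>\<nu>)"
      unfolding E_def V_def by (rule integral_bind_kernel[OF \<nu> Qk _ G2]) simp
    also have "\<dots> = (\<integral>x. \<integral>y. V y \<partial>Q x \<partial>\<mu>)"
      unfolding \<nu>_def by (rule integral_bind_kernel[OF Suc.prems Q V_meas V_le])
    finally show ?thesis .
  qed
  have next_u: "(\<integral>y. g y \<partial>kernel_pow Q (Suc k) x) = (\<integral>y. u y \<partial>Q x)" for x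
    unfolding kernel_pow_Suc'[OF Q] u_def
    by (rule integral_bind_kernel[OF kernel_in_prob_measures[OF Q] Qk _ D(1)]) simp
  have step: "(\<integral>y. (u y)\<^sup>2 \<partial>Q x) - (\<integral>y. u y \<partial>Q x)\<^sup>2 \<le> C * (c k)\<^sup>2 * (\<integral>y. V y \<partial>Q x)" for x
  proof -
    obtain K' where K': "upgrad K' u (\<lambda>x. c k * sqrt (V x))"
      using upgrad_kernel[OF kernel_in_prob_measures[OF Qk] c W gG] unfolding u_def V_def by blast
    have "poincare (Q x) C" using LP by (simp add: local_poincare_def)
    from poincare_upgrad[OF kernel_in_prob_measures[OF Q] C this K']
    have "(\<integral>y. (u y)\<^sup>2 \<partial>Q x) - (\<integral>y. u y \<partial>Q x)\<^sup>2 \<le> C * (\<integral>y. (c k)\<^sup>2 * V y \<partial>Q x)"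
      by (simp add: power_mult_distrib V0)
    then show ?thesis by (simp add: mult.assoc)
  qed
  have int1: "integrable \<mu> (\<lambda>x. \<integral>y. (u y)\<^sup>2 \<partial>Q x)"
    by (intro integrable_bounded[OF Suc.prems, of _ "K\<^sup>2"] measurable_kernel_integral[OF Q]
        abs_kernel_integral_le[OF Q] u2_le) auto
  have int2: "integrable \<mu> (\<lambda>x. (\<integral>y. u y \<partial>Q x)\<^sup>2)"
    by (intro integrable_bounded[OF Suc.prems, of _ "K\<^sup>2"] borel_measurable_power
        measurable_kernel_integral[OF Q])
     (auto intro!: abs_square_le abs_kernel_integral_le[OF Q] u_le)
  have int3: "integrable \<mu> (\<lambda>x. \<integral>y. V y \<partial>Q x)"
    by (intro integrable_bounded[OF Suc.prems, of _ "K\<^sup>2"] measurable_kernel_integral[OF Q]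
        abs_kernel_integral_le[OF Q] V_le) auto
  have "(\<integral>x. (u x)\<^sup>2 \<partial>\<nu>) = (\<integral>x. \<integral>y. (u y)\<^sup>2 \<partial>Q x \<partial>\<mu>)"
    unfolding \<nu>_def by (rule integral_bind_kernel[OF Suc.prems Q _ u2_le]) simp
  then have "(\<integral>x. (u x)\<^sup>2 \<partial>\<nu>) - (\<integral>x. (\<integral>y. u y \<partial>Q x)\<^sup>2 \<partial>\<mu>)
      = (\<integral>x. (\<integral>y. (u y)\<^sup>2 \<partial>Q x) - (\<integral>y. u y \<partial>Q x)\<^sup>2 \<partial>\<mu>)"
    using int1 int2 by simp
  also have "\<dots> \<le> (\<integral>x. C * (c k)\<^sup>2 * (\<integral>y. V y \<partial>Q x) \<partial>\<mu>)"
    using int1 int2 int3 step by (intro integral_mono) auto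
  also have "\<dots> = C * (c k)\<^sup>2 * E"
    by (simp add: E)
  finally have "(\<integral>x. (u x)\<^sup>2 \<partial>\<nu>) - (\<integral>x. (\<integral>y. u y \<partial>Q x)\<^sup>2 \<partial>\<mu>) \<le> C * (c k)\<^sup>2 * E" .
  moreover have "(\<integral>x. (g x)\<^sup>2 \<partial>(\<nu> \<bind> kernel_pow Q k)) - (\<integral>x. (u x)\<^sup>2 \<partial>\<nu>) \<le> C * (\<Sum>j<k. (c j)\<^sup>2) * E"
    unfolding u_def E_def by (rule Suc.IH[OF \<nu>])
  ultimately show ?case
    unfolding eq next_u E_def[symmetric] by (simp add: algebra_simps)
qed

text \<open>Completing the partial sum to the full series makes the bound uniform in
  \<open>k\<close>, as the limit for the invariant measure requires.\<close>

lemma sum_geometric_squares_le: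
  fixes M r :: real
  assumes "0 \<le> r" "r < 1"
  shows "(\<Sum>j<k. (M * r ^ j)\<^sup>2) \<le> M\<^sup>2 / (1 - r\<^sup>2)"
proof -
  have r2: "r\<^sup>2 < 1" using assms by (simp add: power_less_one_iff abs_square_less_1)
  have "(\<Sum>j<k. (M * r ^ j)\<^sup>2) = M\<^sup>2 * (\<Sum>j<k. (r\<^sup>2) ^ j)"
    by (simp add: power_mult_distrib sum_distrib_left power_commutes flip: power_mult) (simp add: mult.commute)
  also have "(\<Sum>j<k. (r\<^sup>2) ^ j) = (1 - (r\<^sup>2) ^ k) / (1 - r\<^sup>2)"
    using r2 by (subst sum_gp_strict) auto
  also have "M\<^sup>2 * \<dots> \<le> M\<^sup>2 * (1 / (1 - r\<^sup>2))"
    using r2 by (intro mult_left_mono divide_right_mono) auto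
  finally show ?thesis by simp
qed

theorem theorem2p6:
  fixes Q :: "real ^ 'd \<Rightarrow> (real ^ 'd) measure"
    and M w C_LP :: real
  assumes "markov_kernel Q"
    and "M > 1" and "1 > w" and "w > 0"
    and "\<And>\<mu> \<nu> k. \<mu> \<in> prob_measures \<Longrightarrow> \<nu> \<in> prob_measures \<Longrightarrow>
           W2 (\<mu> \<bind> kernel_pow Q k) (\<nu> \<bind> kernel_pow Q k) \<le> ennreal (M * (1 - w) ^ k) * W2 \<mu> \<nu>"
    and "local_poincare Q C_LP"
  shows "(\<forall>k. local_poincare (kernel_pow Q k) (C_LP * M\<^sup>2 / (1 - (1 - w)\<^sup>2))) \<and>
         (\<forall>m. invariant_measure Q m \<longrightarrow> poincare m (C_LP * M\<^sup>2 / (1 - (1 - w)\<^sup>2)))"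
proof (intro conjI allI impI)
  note Q = \<open>markov_kernel Q\<close>
  define c where "c k = M * (1 - w) ^ k" for k
  let ?C = "C_LP * M\<^sup>2 / (1 - (1 - w)\<^sup>2)"
  have c: "0 \<le> c k" for k
    using assms(2-4) by (simp add: c_def)
  have W: "W2 (kernel_pow Q k x) (kernel_pow Q k y) \<le> ennreal (c k * dist x y)" for k x y
  proof -
    have "W2 (kernel_pow Q k x) (kernel_pow Q k y) \<le> ennreal (c k) * W2 (return borel x) (return borel y)"
      using assms(5)[OF return_in_prob_measures return_in_prob_measures, of x k y]
      by (simp add: return_bind_kernel[OF markov_kernel_pow[OF Q]] c_def)
    also have "\<dots> \<le> ennreal (c k) * ennreal (dist x y)"
      by (intro mult_left_mono W2_return_le) simp
    finally show ?thesis
      by (simp add: ennreal_mult c)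
  qed
  have CLP: "0 \<le> C_LP"
    using poincare_constant_nonneg[OF kernel_in_prob_measures[OF Q]] assms(6)
    by (auto simp: local_poincare_def)
  have "(1 - w)\<^sup>2 \<le> 1" using assms(3,4) by (simp add: power_le_one)
  then have C: "0 \<le> ?C" using CLP by simp
  \<comment> \<open>An arbitrary starting law serves both claims: a Dirac measure gives the local
    inequality, an invariant measure the global one.\<close>
  have bound: "(\<integral>x. (g x)\<^sup>2 \<partial>(\<mu> \<bind> kernel_pow Q k)) - (\<integral>x. (\<integral>y. g y \<partial>kernel_pow Q k x)\<^sup>2 \<partial>\<mu>)
      \<le> ?C * (\<integral>x. (G x)\<^sup>2 \<partial>(\<mu> \<bind> kernel_pow Q k))"
    if "\<mu> \<in> prob_measures" "upgrad K g G" for \<mu> K g G k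
  proof -
    have "C_LP * (\<Sum>j<k. (c j)\<^sup>2) \<le> C_LP * (M\<^sup>2 / (1 - (1 - w)\<^sup>2))"
      unfolding c_def using assms(3,4) by (intro mult_left_mono sum_geometric_squares_le CLP) auto
    then have "C_LP * (\<Sum>j<k. (c j)\<^sup>2) \<le> ?C"
      by simp
    then have "C_LP * (\<Sum>j<k. (c j)\<^sup>2) * (\<integral>x. (G x)\<^sup>2 \<partial>(\<mu> \<bind> kernel_pow Q k))
        \<le> ?C * (\<integral>x. (G x)\<^sup>2 \<partial>(\<mu> \<bind> kernel_pow Q k))"
      by (rule mult_right_mono) simp
    with variance_kernel_pow[OF Q assms(6) that(2) c W that(1), of k] show ?thesis
      by (rule order_trans)
  qed
  show "local_poincare (kernel_pow Q k) ?C" for k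
    unfolding local_poincare_def
  proof
    fix x
    note Qk = markov_kernel_pow[OF Q, of k]
    have "compact_poincare (kernel_pow Q k x) ?C"
      unfolding compact_poincare_def
    proof (intro allI impI, elim conjE)
      fix K r g G assume gG: "upgrad K g (G :: real ^ 'd \<Rightarrow> real)"
      note [measurable] = upgrad_measurable[OF gG]
      have "(\<integral>z. (\<integral>y. g y \<partial>kernel_pow Q k z)\<^sup>2 \<partial>return borel x) = (\<integral>y. g y \<partial>kernel_pow Q k x)\<^sup>2"
        using measurable_kernel_integral[OF Qk, of g] by (intro integral_return) auto
      with bound[OF return_in_prob_measures gG, of x k]
      show "(\<integral>y. (g y)\<^sup>2 \<partial>kernel_pow Q k x) - (\<integral>y. g y \<partial>kernel_pow Q k x)\<^sup>2
          \<le> ?C * (\<integral>y. (G y)\<^sup>2 \<partial>kernel_pow Q k x)"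
        unfolding return_bind_kernel[OF Qk] by simp
    qed
    then show "poincare (kernel_pow Q k x) ?C"
      by (rule compact_poincare_imp_poincare[OF kernel_in_prob_measures[OF Qk] C])
  qed
  fix m assume "invariant_measure Q m"
  then have m: "m \<in> prob_measures" "m \<bind> Q = m"
    by (auto simp: invariant_measure_def)
  have m_pow: "m \<bind> kernel_pow Q k = m" for k
    by (induction k) (simp_all only: bind_kernel_pow_Suc[OF m(1) Q] m(2) kernel_pow.simps(1) bind_return_borel[OF m(1)])
  interpret prob_space m using prob_measuresD[OF m(1)] by simp
  have "compact_poincare m ?C"
    unfolding compact_poincare_def
  proof (intro allI impI, elim conjE)
    fix K r g G assume gG: "upgrad K g (G :: real ^ 'd \<Rightarrow> real)"
    note D = upgradD[OF gG]
    note [measurable] = upgrad_measurable[OF gG]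
    define u where "u k x = (\<integral>y. g y \<partial>kernel_pow Q k x)" for k x
    have u_meas: "u k \<in> borel_measurable borel" for k
      unfolding u_def by (rule measurable_kernel_integral[OF markov_kernel_pow[OF Q]]) simp
    have u_le: "\<bar>u k x\<bar> \<le> K" for k x
      unfolding u_def by (rule abs_kernel_integral_le[OF markov_kernel_pow[OF Q]]) (auto intro: D)
    have int_u: "(\<integral>y. u k y \<partial>m) = (\<integral>y. g y \<partial>m)" for k
      using integral_bind_kernel[OF m(1) markov_kernel_pow[OF Q, of k] _ D(1)]
      by (simp add: m_pow u_def)
    have c_lim: "c \<longlonglongrightarrow> 0"
      unfolding c_def using assms(3,4) by (intro tendsto_mult_right_zero LIMSEQ_power_zero) auto
    \<comment> \<open>The bound \<open>K\<close> on the root mean square of \<open>G\<close> makes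
      the gradient bound of Q^k g at most K c_k, so values at any two points merge as c_k tends to
      0.\<close>
    have diff_lim: "(\<lambda>k. u k x - u k y) \<longlonglongrightarrow> 0" for x y
    proof (rule Lim_null_comparison)
      have "\<bar>u k x - u k y\<bar> \<le> K * (c k * dist x y) + K * (c k * dist x y)\<^sup>2" for k
      proof -
        have "(\<integral>z. (G z)\<^sup>2 \<partial>kernel_pow Q k x) \<le> K\<^sup>2"
          by (rule order_trans[OF abs_ge_self abs_kernel_integral_le[OF markov_kernel_pow[OF Q]]])
            (auto intro: abs_square_le D)
        then have "sqrt (\<integral>z. (G z)\<^sup>2 \<partial>kernel_pow Q k x) \<le> K"
          using D(6) by (intro real_le_lsqrt) auto
        then have "sqrt (\<integral>z. (G z)\<^sup>2 \<partial>kernel_pow Q k x) * (c k * dist x y) \<le> K * (c k * dist x y)"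
          using c by (intro mult_right_mono) auto
        with W2_upgrad(1)[OF W _ gG, of k x y] c show ?thesis
          unfolding u_def by fastforce
      qed
      then show "\<forall>\<^sub>F k in sequentially. norm (u k x - u k y) \<le> K * (c k * dist x y) + K * (c k * dist x y)\<^sup>2"
        by simp
      have "(\<lambda>k. K * (c k * dist x y) + K * (c k * dist x y)\<^sup>2) \<longlonglongrightarrow> K * (0 * dist x y) + K * (0 * dist x y)\<^sup>2"
        by (intro tendsto_intros c_lim)
      then show "(\<lambda>k. K * (c k * dist x y) + K * (c k * dist x y)\<^sup>2) \<longlonglongrightarrow> 0"
        by simp
    qed
    \<comment> \<open>By invariance every \<open>u k\<close> has the same mean as \<open>g\<close>.
      Averaging the vanishing difference over \<open>y\<close> thus identifies the limit.\<close>
    have u_lim: "(\<lambda>k. u k x) \<longlonglongrightarrow> (\<integral>y. g y \<partial>m)" for x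
    proof -
      have "(\<lambda>k. \<integral>y. u k x - u k y \<partial>m) \<longlonglongrightarrow> (\<integral>y. 0 \<partial>m)"
      proof (rule integral_square_tendsto(2)[OF m(1)])
        show "\<bar>u k x - u k y\<bar> \<le> 2 * K" for k y
          using u_le[of k x] u_le[of k y] by linarith
      qed (use diff_lim u_meas in auto)
      moreover have "(\<integral>y. u k x - u k y \<partial>m) = u k x - (\<integral>y. g y \<partial>m)" for k
        using integrable_bounded[OF m(1) u_meas u_le] by (simp add: int_u prob_space)
      ultimately show ?thesis
        by (simp add: LIM_zero_iff)
    qed
    \<comment> \<open>The subtracted term of \<open>bound\<close> tends to the squared mean, while
      by \<open>m_pow\<close> the other integrals do not depend on \<open>k\<close>.\<close>
    have "(\<lambda>k. \<integral>x. (u k x)\<^sup>2 \<partial>m) \<longlonglongrightarrow> (\<integral>x. (\<integral>y. g y \<partial>m)\<^sup>2 \<partial>m)"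
      by (rule integral_square_tendsto(1)[OF m(1) u_meas u_le u_lim]) simp
    then have "(\<lambda>k. (\<integral>x. (g x)\<^sup>2 \<partial>m) - (\<integral>x. (u k x)\<^sup>2 \<partial>m)) \<longlonglongrightarrow> (\<integral>x. (g x)\<^sup>2 \<partial>m) - (\<integral>y. g y \<partial>m)\<^sup>2"
      by (intro tendsto_diff tendsto_const) (simp add: prob_space)
    moreover have "(\<integral>x. (g x)\<^sup>2 \<partial>m) - (\<integral>x. (u k x)\<^sup>2 \<partial>m) \<le> ?C * (\<integral>x. (G x)\<^sup>2 \<partial>m)" for k
      using bound[OF m(1) gG, of k] by (simp only: m_pow u_def)
    ultimately show "(\<integral>x. (g x)\<^sup>2 \<partial>m) - (\<integral>x. g x \<partial>m)\<^sup>2 \<le> ?C * (\<integral>x. (G x)\<^sup>2 \<partial>m)"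
      by (intro LIMSEQ_le_const2) auto
  qed
  then show "poincare m ?C"
    by (rule compact_poincare_imp_poincare[OF m(1) C])
qed

end
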